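(* Let $X$ be a Banach space and let $\mathcal{E}$ be a monotone complete Banach sequence space with the property $\mathbf{H}(\textit{point-wise})$. Then the K\"othe--Bochner space $\mathcal{E}(X)$ has the property $\mathbf{H}(\textit{weak})$ if, and only if, (1) the space $X$ has the property $\mathbf{H}(\textit{weak})$; and (2) the space $X$ has the Schur property or the space $\mathcal{E}$ is strictly monotone ($\mathbf{SM}$).
   Context: Conventions: unless stated otherwise, Banach spaces are real and infinite-dimensional. Banach sequence space on a countable set $\Gamma$: a Banach space $\mathcal{E}$ that is a linear subspace of the space $\omega(\Gamma)$ of all real functions on $\Gamma$, contains the characteristic functions of all finite subsets of $\Gamma$, and has the ideal property: if $|x(\gamma)|\le|y(\gamma)|$ for all $\gamma\in\Gamma$ and $y\in\mathcal{E}$, then $x\in\mathcal{E}$ and $\|x\|\le\|y\|$. It is monotone complete if every increasing sequence of positive functions from its closed unit ball converges point-wise to some element of $\mathcal{E}$. It is strictly monotone ($\mathbf{SM}$) if $0\le y\le x$, $y\ne x$, $x,y\in\mathcal{E}$ imply $\|y\|<\|x\|$. K\"othe--Bochner sequence space: $\mathcal{E}(X)$ is the Banach space of all functions $x\colon\Gamma\to X$ with $\gamma\mapsto\|x(\gamma)\|_X$ in $\mathcal{E}$, with norm $\|x\|=\big\|\gamma\mapsto\|x(\gamma)\|_X\big\|_{\mathcal{E}}$. Kadets--Klee property: for a linear Hausdorff topology $\mathfrak{T}$ on a Banach space $Y$ coarser (not necessarily strictly) than the norm topology, $Y$ has $\mathbf{H}(\mathfrak{T})$ if whenever $x_n,x$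 lie on the unit sphere of $Y$ and $x_n\to x$ in $\mathfrak{T}$, then $\|x_n-x\|\to0$. $\mathbf{H}(\textit{weak})$ and $\mathbf{H}(\textit{point-wise})$ refer to the weak topology and (on Banach sequence spaces) the topology of point-wise convergence. Schur property: every weakly convergent sequence is norm convergent. *)

theory Defs
  imports "HOL-Analysis.Analysis" "HOL-Library.Function_Algebras"
begin

instantiation "fun" :: (type, real_vector) real_vector
begin

definition scaleR_fun :: "real \<Rightarrow> ('a \<Rightarrow> 'b) \<Rightarrow> 'a \<Rightarrow> 'b"
  where "scaleR_fun c f = (\<lambda>x. c *\<^sub>R f x)"

instance
  by standard (auto simp: scaleR_fun_def plus_fun_def fun_eq_iff scaleR_add_right scaleR_add_left)

end


text \<open>
  Sequence spaces and Koethe--Bochner spaces are subspaces of function spaces, with a norm of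
  their own. Hence a normed space is given here by a carrier \<open>V\<close> inside a real vector space and a
  function \<open>N\<close>, of which only the values on \<open>V\<close> matter. A space \<open>X\<close> of type class
  \<^class>\<open>banach\<close> is the case \<open>V = UNIV\<close>, \<open>N = norm\<close>.
\<close>

definition normed_space_on :: "'a::real_vector set \<Rightarrow> ('a \<Rightarrow> real) \<Rightarrow> bool" where
  "normed_space_on V N \<longleftrightarrow>
     subspace V \<and>
     (\<forall>x\<in>V. 0 \<le> N x \<and> (N x = 0 \<longleftrightarrow> x = 0)) \<and>
     (\<forall>x\<in>V. \<forall>y\<in>V. N (x + y) \<le> N x + N y) \<and>
     (\<forall>c. \<forall>x\<in>V. N (c *\<^sub>R x) = \<bar>c\<bar> * N x)"

definition banach_space_on :: "'a::real_vector set \<Rightarrow> ('a \<Rightarrow> real) \<Rightarrow> bool" where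
  "banach_space_on V N \<longleftrightarrow>
     normed_space_on V N \<and> Metric_space.mcomplete V (\<lambda>x y. N (x - y))"

definition infinite_dimensional :: "'a::real_vector set \<Rightarrow> bool" where
  "infinite_dimensional V \<longleftrightarrow> \<not> (\<exists>B. finite B \<and> V \<subseteq> span B)"

text \<open>
  Functionals are total functions; their values outside \<open>V\<close> are irrelevant, so an element of the
  dual space has many representatives in \<open>dual_on V N\<close>.
\<close>

definition dual_on :: "'a::real_vector set \<Rightarrow> ('a \<Rightarrow> real) \<Rightarrow> ('a \<Rightarrow> real) set" where
  "dual_on V N = {\<phi>.
     (\<forall>x\<in>V. \<forall>y\<in>V. \<phi> (x + y) = \<phi> x + \<phi> y) \<and>
     (\<forall>c. \<forall>x\<in>V. \<phi> (c *\<^sub>R x) = c * \<phi> x) \<and>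
     (\<exists>C. \<forall>x\<in>V. \<bar>\<phi> x\<bar> \<le> C * N x)}"

definition weak_topology :: "'a::real_vector set \<Rightarrow> ('a \<Rightarrow> real) \<Rightarrow> 'a topology" where
  "weak_topology V N =
     topology_generated_by {{x \<in> V. \<phi> x \<in> U} | \<phi> U. \<phi> \<in> dual_on V N \<and> open U}"

definition pointwise_topology :: "('g \<Rightarrow> real) set \<Rightarrow> ('g \<Rightarrow> real) topology" where
  "pointwise_topology E = subtopology (product_topology (\<lambda>_. euclideanreal) UNIV) E"

text \<open>
  The Kadets--Klee property \<open>H(T)\<close>; \<open>T\<close> is meant to be a linear Hausdorff topology on \<open>V\<close>,
  coarser than the norm topology.
\<close>

definition kadets_klee ::
    "'a::real_vector set \<Rightarrow> ('a \<Rightarrow> real) \<Rightarrow> 'a topology \<Rightarrow> bool" where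
  "kadets_klee V N T \<longleftrightarrow>
     (\<forall>xs x. (\<forall>n. xs n \<in> V \<and> N (xs n) = 1) \<and> x \<in> V \<and> N x = 1 \<and> limitin T xs x sequentially
        \<longrightarrow> (\<lambda>n. N (xs n - x)) \<longlonglongrightarrow> 0)"

abbreviation H_weak :: "'a::real_vector set \<Rightarrow> ('a \<Rightarrow> real) \<Rightarrow> bool" where
  "H_weak V N \<equiv> kadets_klee V N (weak_topology V N)"

abbreviation H_pointwise :: "('g \<Rightarrow> real) set \<Rightarrow> (('g \<Rightarrow> real) \<Rightarrow> real) \<Rightarrow> bool" where
  "H_pointwise E N \<equiv> kadets_klee E N (pointwise_topology E)"

definition schur_property :: "'a::real_vector set \<Rightarrow> ('a \<Rightarrow> real) \<Rightarrow> bool" where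
  "schur_property V N \<longleftrightarrow>
     (\<forall>xs. (\<forall>n. xs n \<in> V) \<and> (\<exists>x. limitin (weak_topology V N) xs x sequentially)
        \<longrightarrow> (\<exists>y\<in>V. (\<lambda>n. N (xs n - y)) \<longlonglongrightarrow> 0))"

text \<open>
  The countable index set is a type of class \<^class>\<open>countable\<close>. Below, \<open>0\<close>, \<open>\<le>\<close> and
  \<^const>\<open>incseq\<close> refer to the pointwise zero and order on functions.
\<close>

definition banach_sequence_space ::
    "('g::countable \<Rightarrow> real) set \<Rightarrow> (('g \<Rightarrow> real) \<Rightarrow> real) \<Rightarrow> bool" where
  "banach_sequence_space E N \<longleftrightarrow>
     banach_space_on E N \<and>
     infinite_dimensional E \<and>
     (\<forall>A. finite A \<longrightarrow> indicat_real A \<in> E) \<and>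
     (\<forall>x y. y \<in> E \<and> (\<forall>\<gamma>. \<bar>x \<gamma>\<bar> \<le> \<bar>y \<gamma>\<bar>) \<longrightarrow> x \<in> E \<and> N x \<le> N y)"

definition monotone_complete ::
    "('g::countable \<Rightarrow> real) set \<Rightarrow> (('g \<Rightarrow> real) \<Rightarrow> real) \<Rightarrow> bool" where
  "monotone_complete E N \<longleftrightarrow>
     (\<forall>f. incseq f \<and> (\<forall>n. f n \<in> E \<and> 0 \<le> f n \<and> N (f n) \<le> 1)
        \<longrightarrow> (\<exists>g\<in>E. \<forall>\<gamma>. (\<lambda>n. f n \<gamma>) \<longlonglongrightarrow> g \<gamma>))"

definition strictly_monotone ::
    "('g::countable \<Rightarrow> real) set \<Rightarrow> (('g \<Rightarrow> real) \<Rightarrow> real) \<Rightarrow> bool" where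
  "strictly_monotone E N \<longleftrightarrow>
     (\<forall>x\<in>E. \<forall>y\<in>E. 0 \<le> y \<and> y \<le> x \<and> y \<noteq> x \<longrightarrow> N y < N x)"

definition kothe_bochner ::
    "('g::countable \<Rightarrow> real) set \<Rightarrow> ('g \<Rightarrow> 'x::real_normed_vector) set" where
  "kothe_bochner E = {x. (\<lambda>\<gamma>. norm (x \<gamma>)) \<in> E}"

definition kothe_bochner_norm ::
    "(('g::countable \<Rightarrow> real) \<Rightarrow> real) \<Rightarrow> ('g \<Rightarrow> 'x::real_normed_vector) \<Rightarrow> real" where
  "kothe_bochner_norm N x = N (\<lambda>\<gamma>. norm (x \<gamma>))"

end

theory Submission
  imports Defs
begin

text \<open>
  Three facts carry the proof.

  \<^emph>\<open>Order continuity.\<close> The property \<open>H(point-wise)\<close> and monotone completeness force the tails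
  \<open>x 1\<^bsub>\<Gamma> - F\<^esub>\<close> of every \<open>x \<ge> 0\<close> in \<open>E\<close> to tend to zero in norm as the finite set \<open>F\<close> grows
  (\<open>tails_tendsto_zero\<close>). If the finite truncations of \<open>x\<close> are not Cauchy, then \<open>x\<close> has disjoint
  blocks of norm at least \<open>e > 0\<close>. A greedy choice gives a union of blocks whose norm does not
  change in the limit when one further block, from a sequence of distinct ones, is adjoined
  (\<open>almost_saturated_set\<close>). These enlarged sums converge pointwise and in norm value, so by
  \<open>H(point-wise)\<close> the adjoined blocks would tend to zero. If the truncations are Cauchy, then a
  series of truncated tails, rapidly decreasing in norm, has a sum \<open>g\<close> in \<open>E\<close>, and the tails of
  \<open>x\<close> are dominated by \<open>g / K\<close> for every \<open>K\<close>.

  \<^emph>\<open>Sufficiency.\<close> Let \<open>xs n \<rightarrow> x\<close> weakly on the unit sphere of \<open>E(X)\<close>. All coordinates converge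
  weakly, so \<open>\<parallel>x \<gamma>\<parallel> \<le> liminf \<parallel>xs n \<gamma>\<parallel>\<close>. If \<open>X\<close> has the Schur property, then the norms converge
  coordinatewise. If \<open>E\<close> is strictly monotone, they do as well: were \<open>\<parallel>xs n \<gamma>\<parallel>\<close> at least
  \<open>\<parallel>x \<gamma>\<parallel> + e\<close> infinitely often, then raising the value of \<open>\<parallel>x(\<cdot>)\<parallel>\<close> at \<open>\<gamma>\<close> by \<open>e\<close> would give
  an element which is strictly larger but, by a Fatou argument, still of norm at most one. So the
  coordinates converge in norm by \<open>H(weak)\<close> of \<open>X\<close>, and \<open>\<parallel>xs n(\<cdot>)\<parallel> \<rightarrow> \<parallel>x(\<cdot>)\<parallel>\<close> in \<open>E\<close> by
  \<open>H(point-wise)\<close>. The bound \<open>\<parallel>a - b\<parallel> \<le> \<bar>\<parallel>a\<parallel> - \<parallel>b\<parallel>\<bar> + 2\<parallel>b\<parallel>\<close> makes the tails of \<open>xs n - x\<close>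
  uniformly small, and finitely many coordinates remain.

  \<^emph>\<open>Necessity.\<close> \<open>X\<close> embeds into \<open>E(X)\<close> as a coordinate. If \<open>E\<close> is not strictly monotone, then
  by convexity some coordinate is redundant: \<open>h\<close> and \<open>h + b e\<^sub>\<gamma>\<close> have the same norm although
  \<open>h \<gamma> = 0\<close> and \<open>b > 0\<close>. If \<open>X\<close> is not Schur, there are weakly null unit vectors \<open>u n\<close>. Placing
  \<open>b u n\<close> at the coordinate \<open>\<gamma>\<close> of a copy of \<open>h\<close> changes neither the norm nor the weak limit, but
  the perturbations have constant positive norm.

  Norming functionals come from the Hahn--Banach theorem, derived here from the minimality of
  linear functionals among the sublinear ones.
\<close>

section \<open>Norming functionals\<close>

definition sublinear :: "('a::real_vector \<Rightarrow> real) \<Rightarrow> bool" where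
  "sublinear q \<longleftrightarrow> (\<forall>x y. q (x + y) \<le> q x + q y) \<and> (\<forall>c x. 0 \<le> c \<longrightarrow> q (c *\<^sub>R x) \<le> c * q x)"

lemma sublinear_zero:
  assumes "sublinear q"
  shows "q 0 = 0"
proof -
  have "q (0 + 0) \<le> q 0 + q 0" "q (0 *\<^sub>R 0) \<le> 0 * q 0"
    using assms unfolding sublinear_def by blast+
  then show ?thesis by simp
qed

lemma sublinear_neg:
  assumes "sublinear q"
  shows "- q (- x) \<le> q x"
proof -
  have "q (x + - x) \<le> q x + q (- x)"
    using assms unfolding sublinear_def by blast
  then show ?thesis using sublinear_zero[OF assms] by simp
qed

text \<open>
  The functional \<open>q' x = inf (q (x + t y) - t q y)\<close> over \<open>t \<ge> 0\<close> is \<open>q\<close> made additive in the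
  direction \<open>y\<close>. It serves twice: a minimal \<open>q\<close> must coincide with it, hence be odd, and applied to
  the norm it yields a sublinear functional all of whose linear minorants attain \<open>\<parallel>y\<parallel>\<close> at \<open>y\<close>.
\<close>
lemma sublinear_decrease_at:
  fixes q :: "'a::real_vector \<Rightarrow> real"
  assumes q: "sublinear q"
  obtains q' where "sublinear q'" "\<And>x. q' x \<le> q x" "q' (- y) \<le> - q y"
proof -
  define g where "g x t = q (x + t *\<^sub>R y) - t * q y" for x t
  define q' where "q' x = (INF t\<in>{0..}. g x t)" for x
  have add: "q (u + v) \<le> q u + q v" for u v
    using q unfolding sublinear_def by blast
  have hom: "q (c *\<^sub>R u) \<le> c * q u" if "0 \<le> c" for c u
    using q that unfolding sublinear_def by blast
  have "- q (- x) \<le> g x t" if "t \<ge> 0" for x t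
  proof -
    have "q (t *\<^sub>R y) = t * q y"
    proof (cases "t = 0")
      case False
      then have "q y \<le> inverse t * q (t *\<^sub>R y)"
        using hom[of "inverse t" "t *\<^sub>R y"] that by simp
      then have "t * q y \<le> q (t *\<^sub>R y)" using False that by (simp add: field_simps)
      then show ?thesis using hom[OF that, of y] by simp
    qed (simp add: sublinear_zero[OF q])
    then show ?thesis using add[of "x + t *\<^sub>R y" "- x"] by (simp add: g_def)
  qed
  then have bdd: "bdd_below (g x ` {0..})" for x
    by (intro bdd_belowI[of _ "- q (- x)"]) auto
  have le: "q' x \<le> g x t" if "t \<ge> 0" for x t
    unfolding q'_def using that by (intro cINF_lower bdd) auto
  have ge: "c \<le> q' x" if "\<And>t. t \<ge> 0 \<Longrightarrow> c \<le> g x t" for c x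
    unfolding q'_def using that by (intro cINF_greatest) auto
  have "q' (u + v) \<le> q' u + q' v" for u v
  proof -
    have st: "q' (u + v) \<le> g u s + g v t" if "s \<ge> 0" "t \<ge> 0" for s t
    proof -
      have "q (u + v + (s + t) *\<^sub>R y) \<le> q (u + s *\<^sub>R y) + q (v + t *\<^sub>R y)"
        using add[of "u + s *\<^sub>R y" "v + t *\<^sub>R y"] by (simp add: algebra_simps)
      then show ?thesis using le[of "s + t" "u + v"] that by (simp add: g_def algebra_simps)
    qed
    have "q' (u + v) - g u s \<le> q' v" if "s \<ge> 0" for s
      using st[OF that] by (intro ge) (simp add: algebra_simps)
    then have "q' (u + v) - q' v \<le> q' u"
      by (intro ge) (simp add: algebra_simps)
    then show ?thesis by simp
  qed
  moreover have q'q: "q' x \<le> q x" for x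
    using le[of 0 x] by (simp add: g_def)
  moreover have "q' (c *\<^sub>R x) \<le> c * q' x" if "0 \<le> c" for c x
  proof (cases "c = 0")
    case True
    then show ?thesis using q'q[of 0] sublinear_zero[OF q] by simp
  next
    case False
    have "q' (c *\<^sub>R x) / c \<le> q' x"
    proof (intro ge)
      fix t :: real assume t: "t \<ge> 0"
      have "q' (c *\<^sub>R x) \<le> g (c *\<^sub>R x) (c * t)"
        using le[of "c * t" "c *\<^sub>R x"] t that by simp
      also have "\<dots> \<le> c * g x t"
        using hom[OF that, of "x + t *\<^sub>R y"] by (simp add: g_def algebra_simps)
      finally show "q' (c *\<^sub>R x) / c \<le> g x t" using False that by (simp add: field_simps)
    qed
    then show ?thesis using False that by (simp add: field_simps)
  qed
  moreover have "q' (- y) \<le> - q y"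
    using le[of 1 "- y"] sublinear_zero[OF q] by (simp add: g_def)
  ultimately show ?thesis using that[of q'] unfolding sublinear_def by blast
qed

text \<open>
  On a chain the infimum stays subadditive, as two members are both bounded below by the smaller of
  them; it stays finite because each member satisfies \<open>q x \<ge> - q (- x) \<ge> - p (- x)\<close>.
\<close>
lemma sublinear_INF_chain:
  fixes C :: "('a::real_vector \<Rightarrow> real) set"
  assumes C: "C \<noteq> {}" and sub: "\<And>q. q \<in> C \<Longrightarrow> sublinear q"
    and chain: "\<And>q r. q \<in> C \<Longrightarrow> r \<in> C \<Longrightarrow> q \<le> r \<or> r \<le> q"
    and p: "\<And>q. q \<in> C \<Longrightarrow> q \<le> p"
  shows "sublinear (\<lambda>x. INF q\<in>C. q x)" and "\<And>q x. q \<in> C \<Longrightarrow> (INF q\<in>C. q x) \<le> q x"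
proof -
  have "- p (- x) \<le> q x" if "q \<in> C" for q x
    using sublinear_neg[OF sub[OF that], of x] le_funD[OF p[OF that], of "- x"] by simp
  then have bdd: "bdd_below ((\<lambda>q. q x) ` C)" for x
    by (intro bdd_belowI[of _ "- p (- x)"]) auto
  show le: "(INF q\<in>C. q x) \<le> q x" if "q \<in> C" for q x
    using that by (intro cINF_lower bdd)
  let ?u = "\<lambda>x. INF q\<in>C. q x"
  have ge: "c \<le> ?u x" if "\<And>q. q \<in> C \<Longrightarrow> c \<le> q x" for c x
    using that C by (intro cINF_greatest)
  have "?u (x + y) \<le> ?u x + ?u y" for x y
  proof -
    have qr: "?u (x + y) \<le> q x + r y" if qr: "q \<in> C" "r \<in> C" for q r
    proof -
      obtain m where m: "m \<in> C" "m \<le> q" "m \<le> r" using chain[OF qr] qr by blast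
      have "?u (x + y) \<le> m (x + y)" by (rule le[OF m(1)])
      also have "\<dots> \<le> m x + m y" using sub[OF m(1)] unfolding sublinear_def by blast
      also have "\<dots> \<le> q x + r y" using m by (intro add_mono) (auto dest: le_funD)
      finally show ?thesis .
    qed
    have "?u (x + y) - q x \<le> ?u y" if "q \<in> C" for q
    proof (rule ge)
      fix r assume "r \<in> C"
      from qr[OF that this] show "?u (x + y) - q x \<le> r y" by linarith
    qed
    note * = this
    have "?u (x + y) - ?u y \<le> ?u x"
    proof (rule ge)
      fix q assume "q \<in> C"
      from *[OF this] show "?u (x + y) - ?u y \<le> q x" by linarith
    qed
    then show ?thesis by linarith
  qed
  moreover have "?u (c *\<^sub>R x) \<le> c * ?u x" if c: "0 \<le> c" for c x
  proof (cases "c = 0")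
    case True
    obtain q where "q \<in> C" using C by blast
    then show ?thesis using le[of q 0] sublinear_zero[OF sub, of q] True by simp
  next
    case False
    have "?u (c *\<^sub>R x) / c \<le> ?u x"
    proof (rule ge)
      fix q assume q: "q \<in> C"
      have "?u (c *\<^sub>R x) \<le> q (c *\<^sub>R x)" by (rule le[OF q])
      also have "\<dots> \<le> c * q x" using sub[OF q] c unfolding sublinear_def by blast
      finally show "?u (c *\<^sub>R x) / c \<le> q x" using False c by (simp add: field_simps)
    qed
    then show ?thesis using False c by (simp add: field_simps)
  qed
  ultimately show "sublinear ?u" unfolding sublinear_def by blast
qed

lemma linear_if_sublinear_odd:
  assumes q: "sublinear q" and odd: "\<And>x. q (- x) \<le> - q x"
  shows "linear q"
proof -
  have add: "q (x + y) \<le> q x + q y" for x y using q unfolding sublinear_def by blast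
  have hom: "0 \<le> c \<Longrightarrow> q (c *\<^sub>R x) \<le> c * q x" for c x using q unfolding sublinear_def by blast
  have neg: "q (- x) = - q x" for x
    using odd[of x] sublinear_neg[OF q, of x] by linarith
  have hom': "q (c *\<^sub>R x) = c * q x" if "0 \<le> c" for c x
    using hom[OF that, of x] hom[OF that, of "- x"] by (simp add: neg)
  show ?thesis
  proof (rule linearI)
    show "q (x + y) = q x + q y" for x y
      using add[of x y] add[of "- x" "- y"] neg[of "x + y"] by (simp add: neg)
    show "q (c *\<^sub>R x) = c *\<^sub>R q x" for c x
    proof (cases "0 \<le> c")
      case False
      then show ?thesis using hom'[of "- c" "- x"] by (simp add: neg)
    qed (simp add: hom')
  qed
qed

text \<open>
  Hahn--Banach: a minimal sublinear functional below \<open>p\<close>, which exists by Zorn's lemma, is linear.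
\<close>
theorem sublinear_dominates_linear:
  fixes p :: "'a::real_vector \<Rightarrow> real"
  assumes p: "sublinear p"
  obtains \<phi> where "linear \<phi>" "\<And>x. \<phi> x \<le> p x"
proof -
  let ?A = "{q. sublinear q \<and> q \<le> p}" and ?R = "\<lambda>q r :: 'a \<Rightarrow> real. r \<le> q"
  have "\<exists>m\<in>?A. \<forall>q\<in>?A. q \<le> m \<longrightarrow> q = m"
  proof (rule predicate_Zorn)
    show "partial_order_on ?A (relation_of ?R ?A)"
      by (rule partial_order_on_relation_ofI) auto
    fix C assume "C \<in> Chains (relation_of ?R ?A)"
    then have C: "\<And>q. q \<in> C \<Longrightarrow> sublinear q" "\<And>q. q \<in> C \<Longrightarrow> q \<le> p"
      and ch: "\<And>q r. q \<in> C \<Longrightarrow> r \<in> C \<Longrightarrow> q \<le> r \<or> r \<le> q"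
      unfolding Chains_def relation_of_def by auto
    show "\<exists>u\<in>?A. \<forall>q\<in>C. u \<le> q"
    proof (cases "C = {}")
      case True
      then show ?thesis using p by auto
    next
      case False
      let ?u = "\<lambda>x. INF q\<in>C. q x"
      have "sublinear ?u"
        by (rule sublinear_INF_chain(1)[OF False C(1) ch C(2)])
      moreover have "?u \<le> q" if "q \<in> C" for q
        by (intro le_funI sublinear_INF_chain(2)[OF False C(1) ch C(2) that])
      ultimately show ?thesis using False C(2) by (blast intro: order_trans)
    qed
  qed
  then obtain m where m: "sublinear m" "m \<le> p"
    and min: "\<And>q. sublinear q \<Longrightarrow> q \<le> p \<Longrightarrow> q \<le> m \<Longrightarrow> q = m" by blast
  have "m (- y) \<le> - m y" for y
  proof -
    obtain q where q: "sublinear q" "\<And>x. q x \<le> m x" "q (- y) \<le> - m y"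
      using sublinear_decrease_at[OF m(1)] by metis
    then have "q \<le> m" by (simp add: le_funI)
    then have "q = m" using min q(1) m(2) by (meson order_trans)
    then show ?thesis using q(3) by simp
  qed
  then have "linear m" by (rule linear_if_sublinear_odd[OF m(1)])
  then show ?thesis using that[of m] m(2) by (auto dest: le_funD)
qed

lemma norming_functional:
  fixes x :: "'a::real_normed_vector"
  obtains \<phi> where "\<phi> \<in> dual_on UNIV norm" "\<And>z. \<bar>\<phi> z\<bar> \<le> norm z" "\<phi> x = norm x"
proof -
  have "sublinear (norm :: 'a \<Rightarrow> real)"
    unfolding sublinear_def by (auto intro: norm_triangle_ineq)
  then obtain q where q: "sublinear q" "\<And>z. q z \<le> norm z" "q (- x) \<le> - norm x"
    using sublinear_decrease_at by metis
  obtain \<phi> where \<phi>: "linear \<phi>" "\<And>z. \<phi> z \<le> q z"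
    using sublinear_dominates_linear[OF q(1)] by metis
  have le: "\<phi> z \<le> norm z" for z using \<phi>(2)[of z] q(2)[of z] by linarith
  have neg: "\<phi> (- z) = - \<phi> z" for z by (rule linear_neg[OF \<phi>(1)])
  have abs: "\<bar>\<phi> z\<bar> \<le> norm z" for z using le[of z] le[of "- z"] neg[of z] by simp
  moreover have "\<phi> x = norm x" using \<phi>(2)[of "- x"] q(3) neg[of x] le[of x] by linarith
  moreover have "\<phi> \<in> dual_on UNIV norm"
    unfolding dual_on_def using abs linear_add[OF \<phi>(1)] linear_scale[OF \<phi>(1)]
    by (auto intro!: exI[of _ 1])
  ultimately show ?thesis using that by blast
qed

section \<open>Weak convergence of sequences\<close>

text \<open>
  The sets \<open>{x \<in> V. \<phi> x \<in> U}\<close> form a subbasis, and convergence need only be tested on a subbasis.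
\<close>
lemma limitin_weak_topology:
  "limitin (weak_topology V N) xs x F \<longleftrightarrow>
     x \<in> V \<and> (\<forall>\<^sub>F n in F. xs n \<in> V) \<and> (\<forall>\<phi>\<in>dual_on V N. ((\<lambda>n. \<phi> (xs n)) \<longlongrightarrow> \<phi> x) F)"
  (is "?L \<longleftrightarrow> ?R")
proof
  let ?S = "{{x \<in> V. \<phi> x \<in> U} | \<phi> U. \<phi> \<in> dual_on V N \<and> open U}"
  have zero: "(\<lambda>_. 0) \<in> dual_on V N"
    unfolding dual_on_def by (auto intro!: exI[of _ 0])
  have top: "topspace (weak_topology V N) = V"
    unfolding weak_topology_def topology_generated_by_topspace using zero by blast
  {
    assume L: ?L
    have gen: "openin (weak_topology V N) S" if "S \<in> ?S" for S
      unfolding weak_topology_def by (rule topology_generated_by_Basis[OF that])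
    have V: "x \<in> V" using L unfolding limitin_def top by blast
    have "openin (weak_topology V N) V" using openin_topspace[of "weak_topology V N"] top by simp
    then have "\<forall>\<^sub>F n in F. xs n \<in> V" using L V unfolding limitin_def by blast
    moreover have "((\<lambda>n. \<phi> (xs n)) \<longlongrightarrow> \<phi> x) F" if "\<phi> \<in> dual_on V N" for \<phi>
    proof (rule topological_tendstoI)
      fix U assume U: "open U" "\<phi> x \<in> U"
      have "openin (weak_topology V N) {x \<in> V. \<phi> x \<in> U}" using U that by (intro gen) blast
      then have "\<forall>\<^sub>F n in F. xs n \<in> {x \<in> V. \<phi> x \<in> U}"
        using L U V unfolding limitin_def by blast
      then show "\<forall>\<^sub>F n in F. \<phi> (xs n) \<in> U" by (rule eventually_mono) blast
    qed
    ultimately show ?R using V by blast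
  }
  assume R: ?R
  have "x \<in> U \<longrightarrow> (\<forall>\<^sub>F n in F. xs n \<in> U)" if "generate_topology_on ?S U" for U
    using that
  proof (induction rule: generate_topology_on.induct)
    case (Int a b)
    then show ?case by (auto intro: eventually_conj)
  next
    case (UN K)
    show ?case
    proof
      assume "x \<in> \<Union> K"
      then obtain k where k: "k \<in> K" "x \<in> k" by blast
      then have "\<forall>\<^sub>F n in F. xs n \<in> k" using UN.IH by blast
      then show "\<forall>\<^sub>F n in F. xs n \<in> \<Union> K" by (rule eventually_mono) (use k in blast)
    qed
  next
    case (Basis s)
    then obtain \<phi> U where s: "s = {x \<in> V. \<phi> x \<in> U}" "\<phi> \<in> dual_on V N" "open U" by blast
    show ?case
    proof
      assume "x \<in> s"
      then have "\<forall>\<^sub>F n in F. \<phi> (xs n) \<in> U"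
        using R s topological_tendstoD by fastforce
      then show "\<forall>\<^sub>F n in F. xs n \<in> s"
        using R s(1) by (auto elim: eventually_elim2)
    qed
  qed auto
  then show ?L
    unfolding limitin_def top using R
    by (auto simp: weak_topology_def openin_topology_generated_by_iff)
qed

lemma weak_limit_norm_le:
  fixes x :: "'x::real_normed_vector"
  assumes "limitin (weak_topology UNIV norm) xs x F" and "e > 0"
  shows "\<forall>\<^sub>F n in F. norm x < norm (xs n) + e"
proof -
  obtain \<phi> where \<phi>: "\<phi> \<in> dual_on UNIV norm" "\<And>z. \<bar>\<phi> z\<bar> \<le> norm z" "\<phi> x = norm x"
    using norming_functional by metis
  have "((\<lambda>n. \<phi> (xs n)) \<longlongrightarrow> \<phi> x) F"
    using assms(1) \<phi>(1) unfolding limitin_weak_topology by blast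
  then have "\<forall>\<^sub>F n in F. \<phi> x - e < \<phi> (xs n)"
    using assms(2) by (intro order_tendstoD(1)[where y = "\<phi> x"]) auto
  then show ?thesis
  proof (rule eventually_mono)
    fix n assume "\<phi> x - e < \<phi> (xs n)"
    then show "norm x < norm (xs n) + e" using \<phi>(2)[of "xs n"] \<phi>(3) by linarith
  qed
qed

text \<open>
  The Schur property yields some norm limit; functionals separate points, so it is the weak limit.
\<close>
lemma schur_weak_imp_norm:
  fixes xs :: "nat \<Rightarrow> 'x::real_normed_vector"
  assumes schur: "schur_property (UNIV :: 'x set) norm"
    and lim: "limitin (weak_topology UNIV norm) xs x sequentially"
  shows "xs \<longlonglongrightarrow> x"
proof -
  obtain y where "(\<lambda>n. norm (xs n - y)) \<longlonglongrightarrow> 0"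
    using schur lim unfolding schur_property_def by blast
  then have y: "xs \<longlonglongrightarrow> y" using tendsto_norm_zero_iff LIM_zero_cancel by blast
  obtain \<phi> where \<phi>: "\<phi> \<in> dual_on UNIV norm" "\<And>z. \<bar>\<phi> z\<bar> \<le> norm z" "\<phi> (y - x) = norm (y - x)"
    using norming_functional by metis
  have add: "\<phi> (u + v) = \<phi> u + \<phi> v" for u v using \<phi>(1) unfolding dual_on_def by blast
  have diff: "\<phi> (u - v) = \<phi> u - \<phi> v" for u v using add[of "u - v" v] by simp
  have "(\<lambda>n. \<phi> (xs n - y)) \<longlonglongrightarrow> 0"
    by (rule Lim_null_comparison[OF _ \<open>(\<lambda>n. norm (xs n - y)) \<longlonglongrightarrow> 0\<close>]) (simp add: \<phi>(2))
  then have "(\<lambda>n. \<phi> (xs n)) \<longlonglongrightarrow> \<phi> y" by (simp add: diff LIM_zero_cancel)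
  moreover have "(\<lambda>n. \<phi> (xs n)) \<longlonglongrightarrow> \<phi> x"
    using lim \<phi>(1) unfolding limitin_weak_topology by blast
  ultimately have "\<phi> y = \<phi> x" by (rule LIMSEQ_unique)
  then have "y = x" using \<phi>(3) by (simp add: diff)
  then show ?thesis using y by simp
qed

lemma kadets_kleeD:
  assumes "kadets_klee V N T" "\<And>n. xs n \<in> V" "\<And>n. N (xs n) = 1" "x \<in> V" "N x = 1"
    and "limitin T xs x sequentially"
  shows "(\<lambda>n. N (xs n - x)) \<longlonglongrightarrow> 0"
  using assms unfolding kadets_klee_def by blast

lemma weak_limit_scaleR:
  fixes xs :: "nat \<Rightarrow> 'x::real_normed_vector"
  assumes "limitin (weak_topology UNIV norm) xs x F"
  shows "limitin (weak_topology UNIV norm) (\<lambda>n. c *\<^sub>R xs n) (c *\<^sub>R x) F"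
  unfolding limitin_weak_topology
proof (intro conjI always_eventually allI ballI)
  fix \<phi> :: "'x \<Rightarrow> real" assume \<phi>: "\<phi> \<in> dual_on UNIV norm"
  then have "((\<lambda>n. c * \<phi> (xs n)) \<longlongrightarrow> c * \<phi> x) F"
    using assms unfolding limitin_weak_topology by (intro tendsto_intros) blast
  then show "((\<lambda>n. \<phi> (c *\<^sub>R xs n)) \<longlongrightarrow> \<phi> (c *\<^sub>R x)) F"
    using \<phi> unfolding dual_on_def by simp
qed auto

text \<open>
  Dividing by the norms reduces this to the unit sphere.
\<close>
lemma H_weak_unnormalized:
  fixes xs :: "nat \<Rightarrow> 'x::real_normed_vector"
  assumes H: "H_weak (UNIV :: 'x set) norm"
    and lim: "limitin (weak_topology UNIV norm) xs x sequentially"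
    and norms: "(\<lambda>n. norm (xs n)) \<longlonglongrightarrow> norm x"
  shows "xs \<longlonglongrightarrow> x"
proof (cases "x = 0")
  case True
  then show ?thesis using norms by (simp add: tendsto_norm_zero_iff)
next
  case False
  define z where "z = inverse (norm x) *\<^sub>R x"
  \<comment> \<open>Finitely many terms may vanish; these are replaced by the limit to stay on the sphere.\<close>
  define zs where "zs n = (if xs n = 0 then z else inverse (norm (xs n)) *\<^sub>R xs n)" for n
  have nz: "\<forall>\<^sub>F n in sequentially. xs n \<noteq> 0"
    using order_tendstoD(1)[OF norms, of 0] False by (auto elim: eventually_mono)
  have inv: "(\<lambda>n. inverse (norm (xs n))) \<longlonglongrightarrow> inverse (norm x)"
    using False by (intro tendsto_inverse norms) simp
  have "norm (zs n) = 1" "norm z = 1" for n using False by (simp_all add: zs_def z_def)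
  moreover have "limitin (weak_topology UNIV norm) zs z sequentially"
    unfolding limitin_weak_topology
  proof (intro conjI always_eventually allI ballI)
    fix \<phi> :: "'x \<Rightarrow> real" assume \<phi>: "\<phi> \<in> dual_on UNIV norm"
    then have scale: "\<phi> (c *\<^sub>R u) = c * \<phi> u" for c u unfolding dual_on_def by blast
    have "(\<lambda>n. inverse (norm (xs n)) * \<phi> (xs n)) \<longlonglongrightarrow> inverse (norm x) * \<phi> x"
      using lim \<phi> unfolding limitin_weak_topology by (intro tendsto_mult inv) blast
    moreover have "\<forall>\<^sub>F n in sequentially. inverse (norm (xs n)) * \<phi> (xs n) = \<phi> (zs n)"
      using nz by (rule eventually_mono) (simp add: zs_def scale)
    ultimately show "(\<lambda>n. \<phi> (zs n)) \<longlonglongrightarrow> \<phi> z"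
      unfolding z_def scale by (rule Lim_transform_eventually)
  qed auto
  ultimately have "(\<lambda>n. norm (zs n - z)) \<longlonglongrightarrow> 0"
    using H unfolding kadets_klee_def by blast
  then have "zs \<longlonglongrightarrow> z" by (simp add: LIM_zero_iff tendsto_norm_zero_iff)
  then have "(\<lambda>n. norm (xs n) *\<^sub>R zs n) \<longlonglongrightarrow> norm x *\<^sub>R z" by (intro tendsto_scaleR norms)
  moreover have "\<forall>\<^sub>F n in sequentially. norm (xs n) *\<^sub>R zs n = xs n"
    using nz by (rule eventually_mono) (simp add: zs_def)
  ultimately have "xs \<longlonglongrightarrow> norm x *\<^sub>R z" by (rule Lim_transform_eventually)
  then show ?thesis using False by (simp add: z_def)
qed

text \<open>
  Normalizing the differences \<open>xs n - x\<close> along a subsequence where their norms are at least \<open>e\<close>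
  multiplies the values of functionals by at most \<open>1 / e\<close>, so weak convergence to zero survives
  whether or not the norms are bounded.
\<close>
lemma not_schur_imp_unit_weakly_null:
  assumes "\<not> schur_property (UNIV :: 'x::real_normed_vector set) norm"
  obtains u :: "nat \<Rightarrow> 'x::real_normed_vector" where "\<And>n. norm (u n) = 1"
    "limitin (weak_topology UNIV norm) u 0 sequentially"
proof -
  obtain xs :: "nat \<Rightarrow> 'x" and x where lim: "limitin (weak_topology UNIV norm) xs x sequentially"
    and "\<not> (\<lambda>n. norm (xs n - x)) \<longlonglongrightarrow> 0"
    using assms unfolding schur_property_def by blast
  then obtain e where e: "e > 0" "\<not> (\<forall>\<^sub>F n in sequentially. norm (xs n - x) < e)"
    unfolding tendsto_iff by (auto simp: dist_real_def)
  then have "infinite {n. e \<le> norm (xs n - x)}"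
    by (simp add: not_eventually not_less frequently_cofinite cofinite_eq_sequentially[symmetric])
  then obtain r :: "nat \<Rightarrow> nat" where r: "strict_mono r" "\<And>n. e \<le> norm (xs (r n) - x)"
    using infinite_enumerate by blast
  define u where "u n = inverse (norm (xs (r n) - x)) *\<^sub>R (xs (r n) - x)" for n
  have nz: "xs (r n) - x \<noteq> 0" for n using r(2)[of n] e(1) by auto
  then have "norm (u n) = 1" for n by (simp add: u_def)
  moreover have "limitin (weak_topology UNIV norm) u 0 sequentially"
    unfolding limitin_weak_topology
  proof (intro conjI always_eventually allI ballI)
    fix \<phi> :: "'x \<Rightarrow> real" assume \<phi>: "\<phi> \<in> dual_on UNIV norm"
    then have scale: "\<phi> (c *\<^sub>R u) = c * \<phi> u" and add: "\<phi> (u + v) = \<phi> u + \<phi> v" for c u v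
      unfolding dual_on_def by blast+
    have diff: "\<phi> (u - v) = \<phi> u - \<phi> v" for u v using add[of "u - v" v] by simp
    have "(\<lambda>n. \<phi> (xs n)) \<longlonglongrightarrow> \<phi> x" using lim \<phi> unfolding limitin_weak_topology by blast
    then have "(\<lambda>n. \<phi> (xs (r n))) \<longlonglongrightarrow> \<phi> x"
      using LIMSEQ_subseq_LIMSEQ[OF _ r(1)] by (fastforce simp: o_def)
    then have "(\<lambda>n. \<bar>\<phi> (xs (r n)) - \<phi> x\<bar> / e) \<longlonglongrightarrow> \<bar>\<phi> x - \<phi> x\<bar> / e"
      using e(1) by (intro tendsto_intros) auto
    then have small: "(\<lambda>n. \<bar>\<phi> (xs (r n)) - \<phi> x\<bar> / e) \<longlonglongrightarrow> 0" by simp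
    have bound: "norm (\<phi> (u n)) \<le> \<bar>\<phi> (xs (r n)) - \<phi> x\<bar> / e" for n
    proof -
      have "norm (\<phi> (u n)) = \<bar>\<phi> (xs (r n)) - \<phi> x\<bar> / norm (xs (r n) - x)"
        by (simp add: u_def scale diff abs_mult divide_inverse)
      also have "\<dots> \<le> \<bar>\<phi> (xs (r n)) - \<phi> x\<bar> / e"
        using r(2)[of n] e(1) nz[of n] by (intro divide_left_mono mult_pos_pos) simp_all
      finally show ?thesis .
    qed
    have "(\<lambda>n. \<phi> (u n)) \<longlonglongrightarrow> 0"
      by (rule Lim_null_comparison[OF always_eventually[OF allI[OF bound]] small])
    then show "(\<lambda>n. \<phi> (u n)) \<longlonglongrightarrow> \<phi> 0" using scale[of 0 0] by simp
  qed auto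
  ultimately show ?thesis using that by blast
qed

section \<open>Almost saturated sets of natural numbers\<close>

text \<open>
  An increasing sequence of sets \<open>A n\<close> with infinite complement is built together with an increasing
  sequence of finite forbidden sets \<open>F n\<close>. At each step one new point \<open>f n\<close> becomes forbidden, and
  \<open>A (Suc n)\<close> almost maximizes \<open>\<nu>\<close> among the sets with infinite complement that contain \<open>A n\<close> and
  avoid \<open>F (Suc n)\<close>. For the union \<open>U\<close> of the \<open>A n\<close>, the set \<open>insert (f (Suc n)) U\<close> is still a
  competitor at step \<open>n\<close>, so \<open>\<nu>\<close> exceeds \<open>\<nu> U\<close> there by at most the error of that step.
\<close>
lemma almost_saturated_set:
  fixes \<nu> :: "nat set \<Rightarrow> real"
  assumes mono: "\<And>A B. A \<subseteq> B \<Longrightarrow> \<nu> A \<le> \<nu> B" and bdd: "\<And>A. \<nu> A \<le> C"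
  obtains A f where "inj f" "\<And>k :: nat. f k \<notin> A" "(\<lambda>k. \<nu> (insert (f k) A)) \<longlonglongrightarrow> \<nu> A"
proof -
  \<comment> \<open>States are pairs (chosen set, forbidden set). Infinite complements leave room for new forbidden points.\<close>
  define P where "P n S \<longleftrightarrow> infinite (- fst S) \<and> finite (snd S) \<and> fst S \<inter> snd S = {}"
    for n :: nat and S :: "nat set \<times> nat set"
  define Q where "Q n S T \<longleftrightarrow> fst S \<subseteq> fst T \<and> snd S \<subset> snd T \<and>
      (\<forall>B. fst S \<subseteq> B \<and> infinite (- B) \<and> B \<inter> snd T = {} \<longrightarrow> \<nu> B \<le> \<nu> (fst T) + 1 / real (Suc n))"
    for n and S T :: "nat set \<times> nat set"
  have "\<exists>T. P (Suc n) T \<and> Q n S T" if S: "P n S" for n S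
  proof -
    obtain A F where [simp]: "S = (A, F)" by (cases S)
    from S have A: "infinite (- A)" "finite F" "A \<inter> F = {}" by (simp_all add: P_def)
    then have "infinite (- A - F)" by (simp add: Diff_infinite_finite)
    then obtain f where f: "f \<notin> A" "f \<notin> F" by (metis Compl_iff DiffE finite.emptyI ex_in_conv)
    let ?F = "insert f F"
    let ?\<B> = "{B. A \<subseteq> B \<and> infinite (- B) \<and> B \<inter> ?F = {}}"
    have ne: "A \<in> ?\<B>" using A f by auto
    have bd: "bdd_above (\<nu> ` ?\<B>)" using bdd by (intro bdd_aboveI[of _ C]) auto
    have "(SUP B\<in>?\<B>. \<nu> B) - 1 / real (Suc n) < (SUP B\<in>?\<B>. \<nu> B)" by simp
    then obtain A' where A': "A' \<in> ?\<B>" "(SUP B\<in>?\<B>. \<nu> B) - 1 / real (Suc n) < \<nu> A'"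
      using iffD1[OF less_cSUP_iff[OF _ bd]] ne by (metis (no_types, lifting) empty_iff)
    have "\<nu> B \<le> \<nu> A' + 1 / real (Suc n)" if "B \<in> ?\<B>" for B
      using cSUP_upper[OF that bd] A'(2) by linarith
    then have "Q n S (A', ?F)"
      unfolding Q_def using A'(1) f by simp blast
    moreover have "P (Suc n) (A', ?F)" unfolding P_def using A'(1) A(2) by simp
    ultimately show ?thesis by blast
  qed
  moreover have "P 0 ({}, {})" unfolding P_def by simp
  ultimately obtain S where P: "\<And>n. P n (S n)" and Q: "\<And>n. Q n (S n) (S (Suc n))"
    using dependent_nat_choice[of P Q] by blast
  define A where "A n = fst (S n)" for n
  define F where "F n = snd (S n)" for n
  have A_mono: "A m \<subseteq> A n" if "m \<le> n" for m n
    using that by (rule lift_Suc_mono_le[rotated]) (use Q in \<open>auto simp: Q_def A_def\<close>)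
  have F_mono: "F m \<subseteq> F n" if "m \<le> n" for m n
    using that by (rule lift_Suc_mono_le[rotated]) (use Q in \<open>auto simp: Q_def F_def\<close>)
  have disj: "A n \<inter> F m = {}" for m n
  proof -
    have "A (max m n) \<inter> F (max m n) = {}" using P unfolding P_def A_def F_def by blast
    then show ?thesis using A_mono[of n "max m n"] F_mono[of m "max m n"] by auto
  qed
  have "\<exists>f. f \<in> F (Suc n) \<and> f \<notin> F n" for n using Q[of n] unfolding Q_def F_def by blast
  then obtain f where f: "\<And>n. f n \<in> F (Suc n)" "\<And>n. f n \<notin> F n" by metis
  have "f m \<noteq> f n" if "m < n" for m n
    using f(1)[of m] f(2)[of n] F_mono[of "Suc m" n] that by auto
  then have inj: "inj f" by (metis injI linorder_neqE_nat)
  define U where "U = (\<Union>n. A n)"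
  have fU: "f n \<notin> U" for n using f(1)[of n] disj unfolding U_def by auto
  have up: "\<nu> (insert (f (Suc n)) U) \<le> \<nu> U + 1 / real (Suc n)" for n
  proof -
    let ?B = "insert (f (Suc n)) U"
    have "range f - {f (Suc n)} \<subseteq> - ?B" using fU by auto
    moreover have "infinite (range f - {f (Suc n)})"
      using inj by (simp add: range_inj_infinite)
    ultimately have "infinite (- ?B)" using finite_subset by blast
    moreover have "?B \<inter> F (Suc n) = {}" using f(2)[of "Suc n"] disj unfolding U_def by auto
    moreover have "A n \<subseteq> ?B" unfolding U_def by auto
    ultimately have "\<nu> ?B \<le> \<nu> (A (Suc n)) + 1 / real (Suc n)"
      using Q[of n] unfolding Q_def A_def F_def by blast
    also have "\<nu> (A (Suc n)) \<le> \<nu> U" by (rule mono) (auto simp: U_def)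
    finally show ?thesis by simp
  qed
  have "(\<lambda>n. \<nu> (insert (f (Suc n)) U)) \<longlonglongrightarrow> \<nu> U"
  proof (rule tendsto_sandwich)
    show "\<forall>\<^sub>F n in sequentially. \<nu> U \<le> \<nu> (insert (f (Suc n)) U)"
      by (intro always_eventually allI mono) auto
    show "(\<lambda>n. \<nu> U + 1 / real (Suc n)) \<longlonglongrightarrow> \<nu> U"
      using tendsto_add[OF tendsto_const LIMSEQ_Suc[OF lim_inverse_n'], of "\<nu> U"] by simp
  qed (use up in \<open>auto intro: always_eventually\<close>)
  then have "(\<lambda>n. \<nu> (insert (f n) U)) \<longlonglongrightarrow> \<nu> U" by (rule LIMSEQ_imp_Suc)
  then show ?thesis using that inj fU by blast
qed

section \<open>Banach sequence spaces\<close>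

lemma limitin_pointwise_topology:
  "limitin (pointwise_topology E) xs x F \<longleftrightarrow>
     x \<in> E \<and> (\<forall>\<^sub>F n in F. xs n \<in> E) \<and> (\<forall>\<gamma>. ((\<lambda>n. xs n \<gamma>) \<longlongrightarrow> x \<gamma>) F)"
  unfolding pointwise_topology_def limitin_subtopology limitin_componentwise by auto

definition restr :: "'g set \<Rightarrow> ('g \<Rightarrow> real) \<Rightarrow> 'g \<Rightarrow> real" where
  "restr S x = (\<lambda>\<gamma>. if \<gamma> \<in> S then x \<gamma> else 0)"

definition single :: "'g \<Rightarrow> 'a::zero \<Rightarrow> 'g \<Rightarrow> 'a" where
  "single \<gamma> z = (\<lambda>\<delta>. if \<delta> = \<gamma> then z else 0)"

definition initial :: "nat \<Rightarrow> 'g::countable set" where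
  "initial n = {\<gamma>. to_nat \<gamma> < n}"

lemma finite_initial: "finite (initial n)"
  unfolding initial_def using finite_vimageI[OF finite_lessThan inj_to_nat, of n]
  by (simp add: vimage_def)

lemma initial_mono: "m \<le> n \<Longrightarrow> initial m \<subseteq> initial n"
  unfolding initial_def by auto

lemma eventually_in_initial: "\<forall>\<^sub>F n in sequentially. \<gamma> \<in> initial n"
  unfolding initial_def by (simp add: eventually_gt_at_top)

locale sequence_space =
  fixes E :: "('g::countable \<Rightarrow> real) set" and N :: "('g \<Rightarrow> real) \<Rightarrow> real"
  assumes bss: "banach_sequence_space E N"
begin

lemma normed: "normed_space_on E N"
  using bss unfolding banach_sequence_space_def banach_space_on_def by blast

lemma zero_mem: "(\<lambda>\<gamma>. 0) \<in> E"
  using normed subspace_0[of E] unfolding normed_space_on_def by (simp add: zero_fun_def)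

lemma
  assumes "x \<in> E" "y \<in> E"
  shows add_mem: "(\<lambda>\<gamma>. x \<gamma> + y \<gamma>) \<in> E"
    and norm_add_le: "N (\<lambda>\<gamma>. x \<gamma> + y \<gamma>) \<le> N x + N y"
  using normed assms subspace_add[of E x y] unfolding normed_space_on_def
  by (auto simp: plus_fun_def)

lemma
  assumes "x \<in> E"
  shows scale_mem: "(\<lambda>\<gamma>. c * x \<gamma>) \<in> E"
    and norm_scale: "N (\<lambda>\<gamma>. c * x \<gamma>) = \<bar>c\<bar> * N x"
  using normed assms subspace_scale[of E x c] unfolding normed_space_on_def
  by (auto simp: scaleR_fun_def)

lemma norm_nonneg: "x \<in> E \<Longrightarrow> 0 \<le> N x"
  using normed unfolding normed_space_on_def by blast

lemma norm_eq_0_iff: "x \<in> E \<Longrightarrow> N x = 0 \<longleftrightarrow> (\<forall>\<gamma>. x \<gamma> = 0)"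
  using normed unfolding normed_space_on_def by (auto simp: zero_fun_def fun_eq_iff)

lemma
  assumes "y \<in> E" "\<And>\<gamma>. \<bar>x \<gamma>\<bar> \<le> \<bar>y \<gamma>\<bar>"
  shows ideal_mem: "x \<in> E" and norm_mono: "N x \<le> N y"
  using bss assms unfolding banach_sequence_space_def by blast+

lemma diff_mem:
  assumes "x \<in> E" "y \<in> E"
  shows "(\<lambda>\<gamma>. x \<gamma> - y \<gamma>) \<in> E"
  using add_mem[OF assms(1) scale_mem[OF assms(2), of "- 1"]] by simp

lemma
  assumes "finite A" "\<And>i. i \<in> A \<Longrightarrow> x i \<in> E"
  shows sum_mem: "(\<lambda>\<gamma>. \<Sum>i\<in>A. x i \<gamma>) \<in> E"
    and norm_sum_le: "N (\<lambda>\<gamma>. \<Sum>i\<in>A. x i \<gamma>) \<le> (\<Sum>i\<in>A. N (x i))"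
proof -
  have "(\<lambda>\<gamma>. \<Sum>i\<in>A. x i \<gamma>) \<in> E \<and> N (\<lambda>\<gamma>. \<Sum>i\<in>A. x i \<gamma>) \<le> (\<Sum>i\<in>A. N (x i))"
    using assms
  proof (induction rule: finite_induct)
    case empty
    then show ?case using zero_mem norm_eq_0_iff[OF zero_mem] by simp
  next
    case (insert a A)
    then show ?case
      using add_mem[of "x a" "\<lambda>\<gamma>. \<Sum>i\<in>A. x i \<gamma>"] norm_add_le[of "x a" "\<lambda>\<gamma>. \<Sum>i\<in>A. x i \<gamma>"]
      by fastforce
  qed
  then show "(\<lambda>\<gamma>. \<Sum>i\<in>A. x i \<gamma>) \<in> E" "N (\<lambda>\<gamma>. \<Sum>i\<in>A. x i \<gamma>) \<le> (\<Sum>i\<in>A. N (x i))" by auto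
qed

lemma indicator_mem: "finite A \<Longrightarrow> indicat_real A \<in> E"
  using bss unfolding banach_sequence_space_def by blast

lemma single_eq_indicator: "single \<gamma> (c::real) = (\<lambda>\<delta>. c * indicat_real {\<gamma>} \<delta>)"
  by (auto simp: single_def fun_eq_iff)

lemma single_mem: "single \<gamma> (c::real) \<in> E"
  unfolding single_eq_indicator by (intro scale_mem indicator_mem) simp

lemma norm_single: "N (single \<gamma> c) = \<bar>c\<bar> * N (single \<gamma> 1)"
  using norm_scale[OF single_mem, of c \<gamma> 1] by (simp add: single_def if_distrib cong: if_cong)

lemma norm_single_pos: "0 < N (single \<gamma> 1)"
  using norm_nonneg[OF single_mem, of \<gamma> 1] norm_eq_0_iff[OF single_mem, of \<gamma> 1]
  by (auto simp: single_def order_less_le)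

lemma
  assumes "x \<in> E"
  shows restr_mem: "restr S x \<in> E" and norm_restr_le: "N (restr S x) \<le> N x"
  by (rule ideal_mem[OF assms] norm_mono[OF assms]; simp add: restr_def)+

lemma norm_restr_mono: "x \<in> E \<Longrightarrow> S \<subseteq> T \<Longrightarrow> N (restr S x) \<le> N (restr T x)"
  by (rule norm_mono[OF restr_mem]) (auto simp: restr_def)

lemma norm_le_restr_Compl:
  assumes "x \<in> E"
  shows "N x \<le> N (restr S x) + N (restr (- S) x)"
proof -
  have "x = (\<lambda>\<gamma>. restr S x \<gamma> + restr (- S) x \<gamma>)" by (auto simp: restr_def)
  then show ?thesis using norm_add_le[OF restr_mem restr_mem, OF assms assms] by metis
qed

lemma abs_le_norm_single:
  assumes "x \<in> E"
  shows "\<bar>x \<gamma>\<bar> * N (single \<gamma> 1) \<le> N x"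
  using norm_mono[OF assms, of "single \<gamma> (x \<gamma>)"] norm_single[of \<gamma> "x \<gamma>"]
  by (simp add: single_def)

text \<open>
  After division by the norms, \<open>ys n - y\<close> differs from \<open>N (ys n)\<close> times the difference of the
  normalized vectors by the multiple \<open>N (ys n) / N y - 1\<close> of \<open>y\<close>.
\<close>
lemma H_pointwise_unnormalized:
  assumes H: "H_pointwise E N"
    and mem: "\<And>n. ys n \<in> E" "y \<in> E" and pos: "\<And>n. 0 < N (ys n)" "0 < N y"
    and norms: "(\<lambda>n. N (ys n)) \<longlonglongrightarrow> N y" and pw: "\<And>\<gamma>. (\<lambda>n. ys n \<gamma>) \<longlonglongrightarrow> y \<gamma>"
  shows "(\<lambda>n. N (\<lambda>\<gamma>. ys n \<gamma> - y \<gamma>)) \<longlonglongrightarrow> 0"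
proof -
  define zs where "zs n = (\<lambda>\<gamma>. inverse (N (ys n)) * ys n \<gamma>)" for n
  define z where "z = (\<lambda>\<gamma>. inverse (N y) * y \<gamma>)"
  have zmem: "zs n \<in> E" "z \<in> E" for n unfolding zs_def z_def by (intro scale_mem mem)+
  have "N (zs n) = 1" "N z = 1" for n
    using pos(1)[of n] pos(2) by (simp_all add: zs_def z_def norm_scale mem)
  moreover have "limitin (pointwise_topology E) zs z sequentially"
    unfolding limitin_pointwise_topology using zmem
  proof (intro conjI allI always_eventually)
    show "(\<lambda>n. zs n \<gamma>) \<longlonglongrightarrow> z \<gamma>" for \<gamma>
      unfolding zs_def z_def using pos(2)
      by (intro tendsto_mult tendsto_inverse norms pw) auto
  qed
  ultimately have "(\<lambda>n. N (zs n - z)) \<longlonglongrightarrow> 0"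
    using H zmem unfolding kadets_klee_def by blast
  then have "(\<lambda>n. N (ys n) * N (zs n - z) + \<bar>N (ys n) / N y - 1\<bar> * N y) \<longlonglongrightarrow> N y * 0 + \<bar>N y / N y - 1\<bar> * N y"
    using pos(2) by (intro tendsto_intros norms) auto
  then have lim: "(\<lambda>n. N (ys n) * N (zs n - z) + \<bar>N (ys n) / N y - 1\<bar> * N y) \<longlonglongrightarrow> 0"
    using pos(2) by simp
  have le: "N (\<lambda>\<gamma>. ys n \<gamma> - y \<gamma>) \<le> N (ys n) * N (zs n - z) + \<bar>N (ys n) / N y - 1\<bar> * N y" for n
  proof -
    have d: "zs n - z \<in> E" using diff_mem[OF zmem] by (simp add: fun_diff_def)
    have "(\<lambda>\<gamma>. ys n \<gamma> - y \<gamma>) = (\<lambda>\<gamma>. N (ys n) * (zs n - z) \<gamma> + (N (ys n) / N y - 1) * y \<gamma>)"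
      using pos(1)[of n] pos(2) by (auto simp: zs_def z_def field_simps)
    then have "N (\<lambda>\<gamma>. ys n \<gamma> - y \<gamma>)
        \<le> N (\<lambda>\<gamma>. N (ys n) * (zs n - z) \<gamma>) + N (\<lambda>\<gamma>. (N (ys n) / N y - 1) * y \<gamma>)"
      using norm_add_le[OF scale_mem[OF d] scale_mem[OF mem(2)]] by metis
    then show ?thesis using pos(1)[of n] by (simp only: norm_scale d mem abs_of_pos)
  qed
  show ?thesis
    by (rule tendsto_sandwich[OF _ _ tendsto_const lim])
      (use le norm_nonneg[OF diff_mem[OF mem]] in \<open>auto intro: always_eventually\<close>)
qed

end

section \<open>Order continuity\<close>

context sequence_space
begin

text \<open>
  Such blocks would span a copy of \<open>l\<^sup>\<infinity>\<close> in \<open>E\<close>. With \<open>\<nu> A\<close> the norm of the sum of the blocks in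
  \<open>A\<close>, adjoining the blocks \<open>f k\<close> to an almost saturated \<open>A\<close> gives a sequence which converges
  pointwise, as each index lies in at most one block, and whose norms converge; its distance to the
  limit is the norm of the adjoined block.
\<close>
lemma no_bounded_below_blocks:
  assumes H: "H_pointwise E N" and x: "x \<in> E" and e: "e > 0"
    and disj: "disjoint_family B" and blocks: "\<And>k :: nat. e \<le> N (restr (B k) x)"
  shows False
proof -
  define \<nu> where "\<nu> A = N (restr (\<Union>i\<in>A. B i) x)" for A
  have mono: "\<nu> A \<le> \<nu> A'" if "A \<subseteq> A'" for A A'
    unfolding \<nu>_def using that by (intro norm_restr_mono x) auto
  have bdd: "\<nu> A \<le> N x" for A unfolding \<nu>_def by (rule norm_restr_le[OF x])
  obtain A f where f: "inj f" "\<And>k :: nat. f k \<notin> A"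
    and lim: "(\<lambda>k. \<nu> (insert (f k) A)) \<longlonglongrightarrow> \<nu> A"
    by (rule almost_saturated_set[of \<nu>, OF mono bdd]) (assumption | rule that)+
  have ge: "e \<le> \<nu> (insert (f k) A)" for k
    using blocks[of "f k"] mono[of "{f k}" "insert (f k) A"] unfolding \<nu>_def by simp
  have "e \<le> \<nu> A" by (rule LIMSEQ_le_const[OF lim]) (use ge in auto)
  let ?y = "restr (\<Union>i\<in>A. B i) x" and ?ys = "\<lambda>k. restr (\<Union>i\<in>insert (f k) A. B i) x"
  have "(\<lambda>k. N (\<lambda>\<gamma>. ?ys k \<gamma> - ?y \<gamma>)) \<longlonglongrightarrow> 0"
  proof (rule H_pointwise_unnormalized[OF H])
    show "0 < N (?ys k)" for k using ge[of k] e unfolding \<nu>_def by linarith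
    show "0 < N ?y" using \<open>e \<le> \<nu> A\<close> e unfolding \<nu>_def by linarith
    show "(\<lambda>k. N (?ys k)) \<longlonglongrightarrow> N ?y" using lim unfolding \<nu>_def .
    show "(\<lambda>k. ?ys k \<gamma>) \<longlonglongrightarrow> ?y \<gamma>" for \<gamma>
    proof (rule tendsto_eventually)
      have one: "i = j" if "\<gamma> \<in> B i" "\<gamma> \<in> B j" for i j
        using disjoint_family_onD[OF disj, of i j] that by auto
      have "\<exists>l. \<forall>k>l. \<gamma> \<notin> B (f k)"
      proof (cases "\<exists>l. \<gamma> \<in> B (f l)")
        case True
        then obtain l where l: "\<gamma> \<in> B (f l)" ..
        have "\<gamma> \<notin> B (f k)" if "k > l" for k
          using one[OF _ l, of "f k"] injD[OF f(1), of k l] that by auto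
        then show ?thesis by blast
      qed blast
      then obtain l where l: "\<And>k. k > l \<Longrightarrow> \<gamma> \<notin> B (f k)" by blast
      show "\<forall>\<^sub>F k in sequentially. ?ys k \<gamma> = ?y \<gamma>"
        using eventually_gt_at_top[of l] by (rule eventually_mono) (use l in \<open>simp add: restr_def\<close>)
    qed
  qed (intro restr_mem x)+
  moreover have "e \<le> N (\<lambda>\<gamma>. ?ys k \<gamma> - ?y \<gamma>)" for k
  proof -
    have "\<gamma> \<notin> B (f k)" if "i \<in> A" "\<gamma> \<in> B i" for i \<gamma>
      using disjoint_family_onD[OF disj, of i "f k"] that f(2)[of k] by auto
    then have "?ys k \<gamma> - ?y \<gamma> = restr (B (f k)) x \<gamma>" for \<gamma>
      by (auto simp: restr_def)
    then show ?thesis using blocks[of "f k"] by presburger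
  qed
  ultimately have "e \<le> 0" by (meson LIMSEQ_le_const)
  then show False using e by simp
qed

text \<open>
  Choose \<open>M k\<close> so that all finite pieces of \<open>x\<close> beyond \<open>M k\<close> have norm at most \<open>2\<^bsup>-k-1\<^esup>\<close>. The
  increasing sequence \<open>f\<close> of sums of such pieces stays in the unit ball, so it has a pointwise limit
  \<open>g\<close> in \<open>E\<close>. An index beyond \<open>M 0, \<dots>, M (K - 1)\<close> is counted in at least \<open>K\<close> of the pieces,
  hence \<open>K x \<le> g\<close> there, and the tail of \<open>x\<close> has norm at most \<open>N g / K\<close>.
\<close>
lemma tails_tendsto_zero_if_Cauchy:
  assumes mc: "monotone_complete E N" and x: "x \<in> E" and pos: "\<And>\<gamma>. 0 \<le> x \<gamma>"
    and Cauchy: "\<And>e. e > 0 \<Longrightarrow> \<exists>M. \<forall>n\<ge>M. N (restr (initial n - initial M) x) \<le> e"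
  shows "(\<lambda>n. N (restr (- initial n) x)) \<longlonglongrightarrow> 0"
proof -
  have "\<exists>M. \<forall>n\<ge>M. N (restr (initial n - initial M) x) \<le> (1/2) ^ Suc k" for k
    by (rule Cauchy) simp
  then obtain M where M: "\<And>k n. n \<ge> M k \<Longrightarrow> N (restr (initial n - initial (M k)) x) \<le> (1/2) ^ Suc k"
    by metis
  define f where "f j = (\<lambda>\<gamma>. \<Sum>k<j. restr (initial j - initial (M k)) x \<gamma>)" for j
  have rpos: "0 \<le> restr S x \<gamma>" for S \<gamma> using pos by (simp add: restr_def)
  have f_mem: "f j \<in> E" for j unfolding f_def by (intro sum_mem restr_mem x) simp
  have "N (f j) \<le> 1" for j
  proof -
    have small: "N (restr (initial j - initial (M k)) x) \<le> (1/2) ^ Suc k" for k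
    proof (cases "M k \<le> j")
      case False
      then have "initial j - initial (M k) = ({} :: 'g set)" using initial_mono[of j "M k"] by auto
      then show ?thesis using norm_eq_0_iff[OF zero_mem] by (simp only: restr_def Diff_iff if_False empty_iff) simp
    next
      case True
      then show ?thesis by (rule M)
    qed
    have "N (f j) \<le> (\<Sum>k<j. N (restr (initial j - initial (M k)) x))"
      unfolding f_def by (intro norm_sum_le restr_mem x) simp
    also have "\<dots> \<le> (\<Sum>k<j. (1/2) ^ Suc k)" by (intro sum_mono small)
    also have "\<dots> = 1 - (1/2) ^ j" by (induction j) auto
    also have "\<dots> \<le> (1::real)" by simp
    finally show ?thesis .
  qed
  moreover have "incseq f"
  proof (rule incseq_SucI, rule le_funI)
    fix j \<gamma>
    have "f j \<gamma> \<le> (\<Sum>k<j. restr (initial (Suc j) - initial (M k)) x \<gamma>)"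
      unfolding f_def using initial_mono[of j "Suc j"] pos
      by (intro sum_mono) (auto simp: restr_def)
    also have "\<dots> \<le> f (Suc j) \<gamma>" unfolding f_def using rpos by simp
    finally show "f j \<gamma> \<le> f (Suc j) \<gamma>" .
  qed
  moreover have "0 \<le> f j" for j
    unfolding f_def by (auto intro!: le_funI sum_nonneg rpos)
  ultimately obtain g where g: "g \<in> E" "\<And>\<gamma>. (\<lambda>j. f j \<gamma>) \<longlonglongrightarrow> g \<gamma>"
    using mc f_mem unfolding monotone_complete_def by meson
  have small: "real K * N (restr (- initial n) x) \<le> N g" if n: "\<And>k. k < K \<Longrightarrow> M k \<le> n" for K n
  proof -
    have le: "real K * restr (- initial n) x \<gamma> \<le> g \<gamma>" for \<gamma>
    proof (rule LIMSEQ_le_const[OF g(2)])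
      have "\<forall>\<^sub>F j in sequentially. \<gamma> \<in> initial j \<and> K \<le> j"
        by (intro eventually_conj eventually_in_initial eventually_ge_at_top)
      moreover have "real K * restr (- initial n) x \<gamma> \<le> f j \<gamma>" if j: "\<gamma> \<in> initial j \<and> K \<le> j" for j
      proof -
        have "real K * restr (- initial n) x \<gamma> = (\<Sum>k<K. restr (- initial n) x \<gamma>)" by simp
        also have "\<dots> \<le> (\<Sum>k<K. restr (initial j - initial (M k)) x \<gamma>)"
        proof (rule sum_mono)
          fix k assume "k \<in> {..<K}"
          then have "initial (M k) \<subseteq> (initial n :: 'g set)" using n by (intro initial_mono) simp
          then show "restr (- initial n) x \<gamma> \<le> restr (initial j - initial (M k)) x \<gamma>"
            using j pos[of \<gamma>] by (auto simp: restr_def)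
        qed
        also have "\<dots> \<le> f j \<gamma>"
          unfolding f_def using j by (intro sum_mono2 rpos) auto
        finally show ?thesis .
      qed
      ultimately show "\<exists>J. \<forall>j\<ge>J. real K * restr (- initial n) x \<gamma> \<le> f j \<gamma>"
        unfolding eventually_sequentially by blast
    qed
    have "N (\<lambda>\<gamma>. real K * restr (- initial n) x \<gamma>) \<le> N g"
    proof (rule norm_mono[OF g(1)])
      fix \<gamma>
      have "0 \<le> real K * restr (- initial n) x \<gamma>" using rpos by simp
      then show "\<bar>real K * restr (- initial n) x \<gamma>\<bar> \<le> \<bar>g \<gamma>\<bar>"
        using le[of \<gamma>] by linarith
    qed
    then show ?thesis by (simp add: norm_scale restr_mem x)
  qed
  show ?thesis
  proof (rule LIMSEQ_I)
    fix e :: real assume e: "e > 0"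
    obtain K :: nat where K: "N g / e < real K" using reals_Archimedean2 by blast
    obtain n0 where n0: "\<And>k. k < K \<Longrightarrow> M k \<le> n0"
    proof
      show "M k \<le> Max (M ` {..<K})" if "k < K" for k using that by (intro Max_ge) auto
    qed
    have "N (restr (- initial n) x) < e" if "n \<ge> n0" for n
    proof -
      have "real K * N (restr (- initial n) x) \<le> N g"
        using n0 that by (intro small) (meson order_trans)
      also have "N g < real K * e" using K e by (simp add: field_simps)
      finally show ?thesis by (rule mult_left_less_imp_less) simp
    qed
    then show "\<exists>n0. \<forall>n\<ge>n0. norm (N (restr (- initial n) x) - 0) < e"
      using norm_nonneg[OF restr_mem[OF x]] by auto
  qed
qed

text \<open>
  If the truncations were not Cauchy, iterating \<open>M \<mapsto> h M\<close> would cut out disjoint blocks of norm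
  at least \<open>e\<close>.
\<close>
lemma tails_tendsto_zero:
  assumes H: "H_pointwise E N" and mc: "monotone_complete E N"
    and x: "x \<in> E" and pos: "\<And>\<gamma>. 0 \<le> x \<gamma>"
  shows "(\<lambda>n. N (restr (- initial n) x)) \<longlonglongrightarrow> 0"
proof (rule tails_tendsto_zero_if_Cauchy[OF mc x pos], rule ccontr)
  fix e :: real assume e: "e > 0"
  assume "\<nexists>M. \<forall>n\<ge>M. N (restr (initial n - initial M) x) \<le> e"
  then have "\<forall>M. \<exists>n\<ge>M. e < N (restr (initial n - initial M) x)" by (simp add: not_le)
  then obtain h where h: "\<And>M. M \<le> h M" "\<And>M. e < N (restr (initial (h M) - initial M) x)"
    by metis
  define m where "m k = (h ^^ k) 0" for k
  have m_Suc: "m (Suc k) = h (m k)" for k unfolding m_def by simp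
  have m_mono: "m k \<le> m l" if "k \<le> l" for k l
    using that by (rule lift_Suc_mono_le[rotated]) (simp add: m_Suc h)
  define B :: "nat \<Rightarrow> 'g set" where "B k = initial (m (Suc k)) - initial (m k)" for k
  have "B k \<inter> B l = {}" if "k < l" for k l
    using initial_mono[OF m_mono[of "Suc k" l]] that unfolding B_def by auto
  then have "disjoint_family B"
    unfolding disjoint_family_on_def by (metis Int_commute linorder_neqE_nat)
  moreover have "e \<le> N (restr (B k) x)" for k
    using h(2)[of "m k"] unfolding B_def m_Suc by simp
  ultimately show False using no_bounded_below_blocks[OF H x e] by blast
qed

end

section \<open>Pointwise convergence from strict monotonicity\<close>

context sequence_space
begin


text \<open>
  A Fatou property. On a finite set \<open>F\<close> the assumption is eventually uniform, so the truncation of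
  \<open>g\<close> to \<open>F\<close> is below \<open>\<bar>f n\<bar>\<close> plus a small multiple of the indicator of \<open>F\<close>; the tails of \<open>g\<close>
  take care of the rest.
\<close>
lemma norm_le_1_if_asymptotically_dominated:
  assumes tails: "(\<lambda>n. N (restr (- initial n) g)) \<longlonglongrightarrow> 0"
    and mem: "\<And>n. f n \<in> E" "g \<in> E" and le: "\<And>n. N (f n) \<le> 1"
    and pos: "\<And>\<gamma>. 0 \<le> g \<gamma>"
    and below: "\<And>\<gamma> e. e > 0 \<Longrightarrow> \<forall>\<^sub>F n in sequentially. g \<gamma> < f n \<gamma> + e"
  shows "N g \<le> 1"
proof -
  have fin: "N (restr F g) \<le> 1" if F: "finite F" for F
  proof (rule field_le_epsilon)
    fix e :: real assume e: "e > 0"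
    define c where "c = e / (N (indicat_real F) + 1)"
    have I: "indicat_real F \<in> E" by (rule indicator_mem[OF F])
    have c: "c > 0" "c * N (indicat_real F) \<le> e"
      using e norm_nonneg[OF I] by (auto simp: c_def field_simps)
    have "\<forall>\<^sub>F n in sequentially. \<forall>\<gamma>\<in>F. g \<gamma> < f n \<gamma> + c"
      using below[OF c(1)] F by (simp add: eventually_ball_finite)
    then obtain n where n: "\<And>\<gamma>. \<gamma> \<in> F \<Longrightarrow> g \<gamma> < f n \<gamma> + c"
      using eventually_happens'[OF sequentially_bot] by blast
    have a: "(\<lambda>\<gamma>. \<bar>f n \<gamma>\<bar>) \<in> E" "N (\<lambda>\<gamma>. \<bar>f n \<gamma>\<bar>) \<le> N (f n)"
      by (rule ideal_mem[OF mem(1)[of n]] norm_mono[OF mem(1)[of n]]; simp)+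
    have "N (restr F g) \<le> N (\<lambda>\<gamma>. \<bar>f n \<gamma>\<bar> + c * indicat_real F \<gamma>)"
    proof (rule norm_mono[OF add_mem[OF a(1) scale_mem[OF I]]])
      fix \<gamma>
      show "\<bar>restr F g \<gamma>\<bar> \<le> \<bar>\<bar>f n \<gamma>\<bar> + c * indicat_real F \<gamma>\<bar>"
        using n[of \<gamma>] pos[of \<gamma>] c(1) by (cases "\<gamma> \<in> F") (simp_all add: restr_def)
    qed
    also have "\<dots> \<le> N (\<lambda>\<gamma>. \<bar>f n \<gamma>\<bar>) + N (\<lambda>\<gamma>. c * indicat_real F \<gamma>)"
      by (rule norm_add_le[OF a(1) scale_mem[OF I]])
    also have "\<dots> \<le> 1 + e"
      using a(2) le[of n] c by (simp add: norm_scale[OF I])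
    finally show "N (restr F g) \<le> 1 + e" .
  qed
  have "N g - 1 \<le> N (restr (- initial n) g)" for n
    using norm_le_restr_Compl[OF mem(2), of "initial n"] fin[OF finite_initial, of n] by linarith
  then have "N g - 1 \<le> 0" by (intro LIMSEQ_le_const[OF tails]) auto
  then show ?thesis by simp
qed

text \<open>
  Otherwise \<open>f n \<gamma> \<ge> g \<gamma> + e\<close> along a subsequence, and the enlargement \<open>h\<close> of \<open>g\<close> by \<open>e\<close> at \<open>\<gamma>\<close>
  is still asymptotically dominated along it. So \<open>N h \<le> 1 = N g\<close>, against strict monotonicity.
\<close>
lemma pointwise_convergent_if_strictly_monotone:
  assumes tails: "\<And>g. g \<in> E \<Longrightarrow> (\<And>\<gamma>. 0 \<le> g \<gamma>) \<Longrightarrow> (\<lambda>n. N (restr (- initial n) g)) \<longlonglongrightarrow> 0"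
    and SM: "strictly_monotone E N"
    and mem: "\<And>n. f n \<in> E" "g \<in> E" and norms: "\<And>n. N (f n) \<le> 1" "N g = 1"
    and pos: "\<And>\<gamma>. 0 \<le> g \<gamma>"
    and below: "\<And>\<gamma> e. e > 0 \<Longrightarrow> \<forall>\<^sub>F n in sequentially. g \<gamma> < f n \<gamma> + e"
  shows "(\<lambda>n. f n \<gamma>) \<longlonglongrightarrow> g \<gamma>"
proof (rule tendstoI, rule ccontr)
  fix e :: real assume e: "e > 0"
  assume "\<not> (\<forall>\<^sub>F n in sequentially. dist (f n \<gamma>) (g \<gamma>) < e)"
  then have "\<exists>\<^sub>F n in sequentially. \<not> dist (f n \<gamma>) (g \<gamma>) < e" by (simp add: not_eventually)
  then have "\<exists>\<^sub>F n in sequentially. g \<gamma> + e \<le> f n \<gamma>"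
    by (rule frequently_rev_mp)
      (rule eventually_mono[OF below[OF e, of \<gamma>]], auto simp: dist_real_def)
  then have "infinite {n. g \<gamma> + e \<le> f n \<gamma>}" by (simp add: frequently_cofinite cofinite_eq_sequentially[symmetric])
  then obtain r :: "nat \<Rightarrow> nat" where r: "strict_mono r" "\<And>n. g \<gamma> + e \<le> f (r n) \<gamma>"
    using infinite_enumerate by blast
  define h where "h = (\<lambda>\<delta>. g \<delta> + single \<gamma> e \<delta>)"
  have h: "h \<in> E" unfolding h_def by (intro add_mem mem single_mem)
  have hpos: "0 \<le> h \<delta>" for \<delta> using pos[of \<delta>] e by (simp add: h_def single_def)
  have "N h \<le> 1"
  proof (rule norm_le_1_if_asymptotically_dominated[of h "\<lambda>n. f (r n)"])
    show "\<forall>\<^sub>F n in sequentially. h \<delta> < f (r n) \<delta> + d" if "d > 0" for \<delta> d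
    proof (cases "\<delta> = \<gamma>")
      case True
      have "h \<delta> < f (r n) \<delta> + d" for n
        using r(2)[of n] that True by (simp add: h_def single_def)
      then show ?thesis by simp
    next
      case False
      then show ?thesis
        using eventually_subseq[OF r(1) below[OF that, of \<delta>]] by (simp add: h_def single_def)
    qed
  qed (use tails h hpos mem norms in auto)
  moreover have "N g < N h"
  proof -
    have "0 \<le> g" "g \<le> h" using pos e by (auto simp: le_fun_def h_def single_def)
    moreover have "g \<gamma> \<noteq> h \<gamma>" using e by (simp add: h_def single_def)
    ultimately show ?thesis using SM mem(2) h unfolding strictly_monotone_def by metis
  qed
  ultimately show False using norms(2) by simp
qed

end

section \<open>Norm and weak convergence in Koethe--Bochner spaces\<close>

context sequence_space
begin

text \<open>
  Outside a finite set of coordinates, \<open>xs n - x\<close> is controlled uniformly in \<open>n\<close> by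
  \<open>\<parallel>a - b\<parallel> \<le> \<bar>\<parallel>a\<parallel> - \<parallel>b\<parallel>\<bar> + 2\<parallel>b\<parallel>\<close> and the tails of \<open>x\<close>; on the finite set coordinatewise
  convergence suffices.
\<close>
lemma kothe_bochner_norm_tendsto:
  fixes xs :: "nat \<Rightarrow> 'g \<Rightarrow> 'x::real_normed_vector"
  assumes tails: "(\<lambda>n. N (restr (- initial n) (\<lambda>\<gamma>. norm (x \<gamma>)))) \<longlonglongrightarrow> 0"
    and mem: "\<And>n. xs n \<in> kothe_bochner E" "x \<in> kothe_bochner E"
    and norms: "(\<lambda>n. N (\<lambda>\<gamma>. norm (xs n \<gamma>) - norm (x \<gamma>))) \<longlonglongrightarrow> 0"
    and coord: "\<And>\<gamma>. (\<lambda>n. xs n \<gamma>) \<longlonglongrightarrow> x \<gamma>"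
  shows "(\<lambda>n. kothe_bochner_norm N (xs n - x)) \<longlonglongrightarrow> 0"
proof -
  define f where "f n = (\<lambda>\<gamma>. norm (xs n \<gamma>))" for n
  define g where "g = (\<lambda>\<gamma>. norm (x \<gamma>))"
  define d where "d n = (\<lambda>\<gamma>. norm (xs n \<gamma> - x \<gamma>))" for n
  have fE: "f n \<in> E" for n using mem unfolding f_def kothe_bochner_def by simp
  have gE: "g \<in> E" using mem unfolding g_def kothe_bochner_def by simp
  have fg: "(\<lambda>\<gamma>. f n \<gamma> - g \<gamma>) \<in> E" for n by (rule diff_mem[OF fE gE])
  have dE: "d n \<in> E" for n
  proof (rule ideal_mem[OF add_mem[OF fE gE]])
    fix \<gamma> show "\<bar>d n \<gamma>\<bar> \<le> \<bar>f n \<gamma> + g \<gamma>\<bar>"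
      unfolding d_def f_def g_def using norm_triangle_ineq4[of "xs n \<gamma>" "x \<gamma>"] by simp
  qed
  have tail: "N (restr (- F) (d n)) \<le> N (\<lambda>\<gamma>. f n \<gamma> - g \<gamma>) + 2 * N (restr (- F) g)" for F n
  proof -
    let ?a = "\<lambda>\<gamma>. \<bar>f n \<gamma> - g \<gamma>\<bar>"
    have a: "?a \<in> E" "N ?a \<le> N (\<lambda>\<gamma>. f n \<gamma> - g \<gamma>)"
      by (rule ideal_mem[OF fg[of n]] norm_mono[OF fg[of n]]; simp)+
    have r: "restr (- F) g \<in> E" by (rule restr_mem[OF gE])
    have "N (restr (- F) (d n)) \<le> N (\<lambda>\<gamma>. ?a \<gamma> + 2 * restr (- F) g \<gamma>)"
    proof (rule norm_mono[OF add_mem[OF a(1) scale_mem[OF r]]])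
      fix \<gamma>
      have "norm (xs n \<gamma> - x \<gamma>) \<le> norm (xs n \<gamma>) + norm (x \<gamma>)" by (rule norm_triangle_ineq4)
      also have "\<dots> \<le> \<bar>norm (xs n \<gamma>) - norm (x \<gamma>)\<bar> + 2 * norm (x \<gamma>)" by linarith
      finally show "\<bar>restr (- F) (d n) \<gamma>\<bar> \<le> \<bar>?a \<gamma> + 2 * restr (- F) g \<gamma>\<bar>"
        by (simp add: restr_def d_def f_def g_def)
    qed
    also have "\<dots> \<le> N ?a + N (\<lambda>\<gamma>. 2 * restr (- F) g \<gamma>)"
      by (rule norm_add_le[OF a(1) scale_mem[OF r]])
    finally show ?thesis using a(2) norm_scale[OF r, of 2] by simp
  qed
  have head: "(\<lambda>n. N (restr F (d n))) \<longlonglongrightarrow> 0" if F: "finite F" for F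
  proof (rule tendsto_sandwich[OF _ _ tendsto_const])
    have "N (restr F (d n)) \<le> (\<Sum>\<gamma>\<in>F. d n \<gamma> * N (single \<gamma> 1))" for n
    proof -
      have "restr F (d n) = (\<lambda>\<delta>. \<Sum>\<gamma>\<in>F. single \<gamma> (d n \<gamma>) \<delta>)"
        using F by (auto simp: restr_def single_def fun_eq_iff sum.delta')
      then have "N (restr F (d n)) \<le> (\<Sum>\<gamma>\<in>F. N (single \<gamma> (d n \<gamma>)))"
        using norm_sum_le[OF F, of "\<lambda>\<gamma>. single \<gamma> (d n \<gamma>)"] single_mem by simp
      also have "\<dots> = (\<Sum>\<gamma>\<in>F. d n \<gamma> * N (single \<gamma> 1))"
        by (rule sum.cong[OF refl], subst norm_single) (simp add: d_def)
      finally show ?thesis .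
    qed
    then show "\<forall>\<^sub>F n in sequentially. N (restr F (d n)) \<le> (\<Sum>\<gamma>\<in>F. d n \<gamma> * N (single \<gamma> 1))" by simp
    have "(\<lambda>n. d n \<gamma>) \<longlonglongrightarrow> 0" for \<gamma>
      unfolding d_def using coord[of \<gamma>] by (simp add: LIM_zero tendsto_norm_zero)
    then show "(\<lambda>n. \<Sum>\<gamma>\<in>F. d n \<gamma> * N (single \<gamma> 1)) \<longlonglongrightarrow> 0"
      by (intro tendsto_null_sum tendsto_mult_left_zero)
    show "\<forall>\<^sub>F n in sequentially. 0 \<le> N (restr F (d n))"
      using norm_nonneg[OF restr_mem[OF dE]] by simp
  qed
  have "(\<lambda>n. N (d n)) \<longlonglongrightarrow> 0"
  proof (rule LIMSEQ_I)
    fix e :: real assume e: "e > 0"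
    have "\<forall>\<^sub>F k in sequentially. N (restr (- initial k) g) < e / 6"
      using order_tendstoD(2)[OF tails, of "e / 6"] e unfolding g_def by simp
    then obtain k where k: "N (restr (- initial k) g) < e / 6"
      using eventually_happens'[OF sequentially_bot] by blast
    have "\<forall>\<^sub>F n in sequentially. N (restr (initial k) (d n)) < e / 3"
      using order_tendstoD(2)[OF head[OF finite_initial], of "e / 3"] e by simp
    moreover have "\<forall>\<^sub>F n in sequentially. N (\<lambda>\<gamma>. f n \<gamma> - g \<gamma>) < e / 3"
      using order_tendstoD(2)[OF norms, of "e / 3"] e by (simp add: f_def g_def)
    ultimately have "\<forall>\<^sub>F n in sequentially. norm (N (d n) - 0) < e"
    proof eventually_elim
      case (elim n)
      then show ?case
        using norm_le_restr_Compl[OF dE[of n], of "initial k"] tail[of "initial k" n] k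
          norm_nonneg[OF dE[of n]] by simp
    qed
    then show "\<exists>n0. \<forall>n\<ge>n0. norm (N (d n) - 0) < e" by (simp add: eventually_sequentially)
  qed
  then show ?thesis by (simp add: kothe_bochner_norm_def d_def fun_diff_def)
qed

text \<open>
  Evaluation at \<open>\<gamma>\<close> is bounded, because \<open>\<parallel>x \<gamma>\<parallel> e\<^sub>\<gamma>\<close> is dominated by \<open>\<parallel>x(\<cdot>)\<parallel>\<close>.
\<close>
lemma coordinate_functional:
  fixes \<phi> :: "'x::real_normed_vector \<Rightarrow> real"
  assumes "\<phi> \<in> dual_on UNIV norm"
  shows "(\<lambda>x. \<phi> (x \<gamma>)) \<in> dual_on (kothe_bochner E) (kothe_bochner_norm N)"
proof -
  obtain C where C: "\<And>z. \<bar>\<phi> z\<bar> \<le> C * norm z"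
    using assms unfolding dual_on_def by blast
  let ?s = "N (single \<gamma> 1)"
  have "\<bar>\<phi> (x \<gamma>)\<bar> \<le> \<bar>C\<bar> / ?s * kothe_bochner_norm N x" if "x \<in> kothe_bochner E" for x
  proof -
    have "norm (x \<gamma>) * ?s \<le> kothe_bochner_norm N x"
      using abs_le_norm_single[of "\<lambda>\<gamma>. norm (x \<gamma>)" \<gamma>] that
      unfolding kothe_bochner_def kothe_bochner_norm_def by simp
    then have "norm (x \<gamma>) \<le> kothe_bochner_norm N x / ?s"
      using norm_single_pos[of \<gamma>] by (simp add: field_simps)
    then have "\<bar>C\<bar> * norm (x \<gamma>) \<le> \<bar>C\<bar> * (kothe_bochner_norm N x / ?s)"
      by (rule mult_left_mono) simp
    moreover have "C * norm (x \<gamma>) \<le> \<bar>C\<bar> * norm (x \<gamma>)"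
      by (rule mult_right_mono) auto
    ultimately show ?thesis using C[of "x \<gamma>"] by simp
  qed
  then have "\<exists>C. \<forall>x\<in>kothe_bochner E. \<bar>\<phi> (x \<gamma>)\<bar> \<le> C * kothe_bochner_norm N x" by blast
  then show ?thesis
    using assms unfolding dual_on_def by (simp add: plus_fun_def scaleR_fun_def)
qed

lemma weak_limit_coordinate:
  fixes x :: "'g \<Rightarrow> 'x::real_normed_vector"
  assumes "limitin (weak_topology (kothe_bochner E) (kothe_bochner_norm N)) xs x F"
  shows "limitin (weak_topology UNIV norm) (\<lambda>n. xs n \<gamma>) (x \<gamma>) F"
  using assms coordinate_functional unfolding limitin_weak_topology by fastforce

lemma norm_of_single: "norm (single \<gamma> z \<delta>) = single \<gamma> (norm z) \<delta>"
  by (simp add: single_def)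

lemma
  fixes z :: "'x::real_normed_vector"
  shows single_mem_kothe_bochner: "single \<gamma> z \<in> kothe_bochner E"
    and kothe_bochner_norm_single:
      "kothe_bochner_norm N (single \<gamma> z) = norm z * N (single \<gamma> 1)"
  using single_mem[of \<gamma> "norm z"] norm_single[of \<gamma> "norm z"]
  by (simp_all add: kothe_bochner_def kothe_bochner_norm_def norm_of_single eta_contract_eq)

lemma add_mem_kothe_bochner:
  fixes x y :: "'g \<Rightarrow> 'x::real_normed_vector"
  assumes "x \<in> kothe_bochner E" "y \<in> kothe_bochner E"
  shows "x + y \<in> kothe_bochner E"
proof -
  have "(\<lambda>\<gamma>. norm (x \<gamma>) + norm (y \<gamma>)) \<in> E"
    using assms unfolding kothe_bochner_def by (simp add: add_mem)
  then have "(\<lambda>\<gamma>. norm ((x + y) \<gamma>)) \<in> E"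
    by (rule ideal_mem) (simp add: plus_fun_def norm_triangle_ineq)
  then show ?thesis unfolding kothe_bochner_def by simp
qed

text \<open>
  A functional on \<open>E(X)\<close> restricts to a functional on the copy of \<open>X\<close> at the coordinate \<open>\<gamma>\<close>. The
  case \<open>x = 0\<close> serves to embed \<open>X\<close>, the general one to perturb a fixed vector.
\<close>
lemma weak_limit_perturb_coordinate:
  fixes u :: "'x::real_normed_vector"
  assumes lim: "limitin (weak_topology UNIV norm) us u F" and x: "x \<in> kothe_bochner E"
  shows "limitin (weak_topology (kothe_bochner E) (kothe_bochner_norm N))
    (\<lambda>n. x + single \<gamma> (us n)) (x + single \<gamma> u) F"
  unfolding limitin_weak_topology
proof (intro conjI always_eventually allI ballI)
  let ?V = "kothe_bochner E :: ('g \<Rightarrow> 'x) set"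
  fix \<phi> assume \<phi>: "\<phi> \<in> dual_on ?V (kothe_bochner_norm N)"
  then obtain C where add: "\<And>y z. y \<in> ?V \<Longrightarrow> z \<in> ?V \<Longrightarrow> \<phi> (y + z) = \<phi> y + \<phi> z"
    and scale: "\<And>c z. z \<in> ?V \<Longrightarrow> \<phi> (c *\<^sub>R z) = c * \<phi> z"
    and C: "\<And>z. z \<in> ?V \<Longrightarrow> \<bar>\<phi> z\<bar> \<le> C * kothe_bochner_norm N z"
    unfolding dual_on_def by blast
  let ?\<psi> = "\<lambda>z. \<phi> (single \<gamma> z)"
  have "?\<psi> \<in> dual_on UNIV norm"
    unfolding dual_on_def
  proof (intro CollectI conjI ballI allI exI)
    show "?\<psi> (y + z) = ?\<psi> y + ?\<psi> z" for y z
    proof -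
      have "single \<gamma> (y + z) = single \<gamma> y + single \<gamma> z" by (auto simp: single_def plus_fun_def)
      then show ?thesis by (simp add: add single_mem_kothe_bochner)
    qed
    show "?\<psi> (c *\<^sub>R z) = c * ?\<psi> z" for c z
    proof -
      have "single \<gamma> (c *\<^sub>R z) = c *\<^sub>R single \<gamma> z" by (auto simp: single_def scaleR_fun_def)
      then show ?thesis by (simp add: scale single_mem_kothe_bochner)
    qed
    show "\<bar>?\<psi> z\<bar> \<le> (C * N (single \<gamma> 1)) * norm z" for z
      using C[OF single_mem_kothe_bochner[of \<gamma> z]] by (simp add: kothe_bochner_norm_single mult_ac)
  qed
  then have "((\<lambda>n. ?\<psi> (us n)) \<longlongrightarrow> ?\<psi> u) F" using lim unfolding limitin_weak_topology by fast
  then have "((\<lambda>n. \<phi> x + ?\<psi> (us n)) \<longlongrightarrow> \<phi> x + ?\<psi> u) F" by (intro tendsto_intros)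
  then show "((\<lambda>n. \<phi> (x + single \<gamma> (us n))) \<longlongrightarrow> \<phi> (x + single \<gamma> u)) F"
    by (simp add: add x single_mem_kothe_bochner)
qed (intro add_mem_kothe_bochner x single_mem_kothe_bochner)+

end

section \<open>The Kadets--Klee property of Koethe--Bochner spaces\<close>

context sequence_space
begin

lemma H_weak_kothe_bochner:
  assumes H: "H_pointwise E N" and mc: "monotone_complete E N"
    and HX: "H_weak (UNIV :: 'x::real_normed_vector set) norm"
    and or: "schur_property (UNIV :: 'x set) norm \<or> strictly_monotone E N"
  shows "H_weak (kothe_bochner E :: ('g \<Rightarrow> 'x) set) (kothe_bochner_norm N)"
  unfolding kadets_klee_def
proof (intro allI impI, elim conjE)
  fix xs and x :: "'g \<Rightarrow> 'x"
  assume xs: "\<forall>n. xs n \<in> kothe_bochner E \<and> kothe_bochner_norm N (xs n) = 1"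
    and x: "x \<in> kothe_bochner E" "kothe_bochner_norm N x = 1"
    and lim: "limitin (weak_topology (kothe_bochner E) (kothe_bochner_norm N)) xs x sequentially"
  let ?f = "\<lambda>n \<gamma>. norm (xs n \<gamma>)" and ?g = "\<lambda>\<gamma>. norm (x \<gamma>)"
  have f: "?f n \<in> E" "N (?f n) = 1" for n
    using xs unfolding kothe_bochner_def kothe_bochner_norm_def by auto
  have g: "?g \<in> E" "N ?g = 1"
    using x unfolding kothe_bochner_def kothe_bochner_norm_def by auto
  note coord = weak_limit_coordinate[OF lim]
  note tails = tails_tendsto_zero[OF H mc]
  have fg: "(\<lambda>n. ?f n \<gamma>) \<longlonglongrightarrow> ?g \<gamma>" for \<gamma>
    using or
  proof
    assume "schur_property (UNIV :: 'x set) norm"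
    then show ?thesis by (intro tendsto_norm schur_weak_imp_norm coord)
  next
    assume SM: "strictly_monotone E N"
    show ?thesis
      by (rule pointwise_convergent_if_strictly_monotone[of ?f ?g, OF tails SM])
        (use f g weak_limit_norm_le[OF coord] in auto)
  qed
  show "(\<lambda>n. kothe_bochner_norm N (xs n - x)) \<longlonglongrightarrow> 0"
  proof (rule kothe_bochner_norm_tendsto)
    show "(\<lambda>n. N (restr (- initial n) ?g)) \<longlonglongrightarrow> 0" by (rule tails[OF g(1)]) simp
    show "(\<lambda>n. N (\<lambda>\<gamma>. ?f n \<gamma> - ?g \<gamma>)) \<longlonglongrightarrow> 0"
      by (rule H_pointwise_unnormalized[OF H]) (use f g fg in simp_all)
    show "(\<lambda>n. xs n \<gamma>) \<longlonglongrightarrow> x \<gamma>" for \<gamma> by (rule H_weak_unnormalized[OF HX coord fg])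
  qed (use xs x in auto)
qed

text \<open>
  \<open>v \<mapsto> c v e\<^sub>\<gamma>\<close> with \<open>c = 1 / N e\<^sub>\<gamma>\<close> embeds \<open>X\<close> isometrically, and continuously for the weak
  topologies.
\<close>
lemma H_weak_of_kothe_bochner:
  assumes H: "H_weak (kothe_bochner E :: ('g \<Rightarrow> 'x::real_normed_vector) set) (kothe_bochner_norm N)"
  shows "H_weak (UNIV :: 'x set) norm"
  unfolding kadets_klee_def
proof (intro allI impI, elim conjE)
  fix us and u :: 'x
  assume us: "\<forall>n. us n \<in> UNIV \<and> norm (us n) = 1" and u: "norm u = 1"
    and lim: "limitin (weak_topology UNIV norm) us u sequentially"
  fix \<gamma> :: 'g
  define c where "c = inverse (N (single \<gamma> 1))"
  have c: "c > 0" "c * N (single \<gamma> 1) = 1"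
    using norm_single_pos[of \<gamma>] by (simp_all add: c_def)
  let ?S = "\<lambda>v :: 'x. single \<gamma> (c *\<^sub>R v)"
  have nS: "kothe_bochner_norm N (?S v) = norm v" for v
    using c by (simp add: kothe_bochner_norm_single mult_ac)
  have "limitin (weak_topology (kothe_bochner E) (kothe_bochner_norm N)) (\<lambda>n. single \<gamma> 0 + ?S (us n))
    (single \<gamma> 0 + ?S u) sequentially"
    by (intro weak_limit_perturb_coordinate weak_limit_scaleR lim single_mem_kothe_bochner)
  moreover have "single \<gamma> 0 + ?S v = ?S v" for v by (auto simp: single_def plus_fun_def)
  ultimately have "limitin (weak_topology (kothe_bochner E) (kothe_bochner_norm N))
      (\<lambda>n. ?S (us n)) (?S u) sequentially" by simp
  then have "(\<lambda>n. kothe_bochner_norm N (?S (us n) - ?S u)) \<longlonglongrightarrow> 0"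
    using us u by (intro kadets_kleeD[OF H]) (simp_all only: nS single_mem_kothe_bochner)
  moreover have "?S v - ?S w = ?S (v - w)" for v w
    by (auto simp: single_def fun_diff_def scaleR_diff_right)
  ultimately show "(\<lambda>n. norm (us n - u)) \<longlonglongrightarrow> 0" by (simp add: nS)
qed

text \<open>
  Let \<open>y \<le> x\<close> have equal norms and \<open>y \<gamma> < x \<gamma>\<close>, and let \<open>h\<close> be \<open>x\<close> with the value at \<open>\<gamma>\<close>
  replaced by zero. With \<open>t = y \<gamma> / x \<gamma> < 1\<close>, \<open>y\<close> lies below the convex combination
  \<open>(1 - t) h + t x\<close>, so \<open>N x \<le> (1 - t) N h + t N x\<close> and thus \<open>N x \<le> N h\<close>.
\<close>
lemma not_strictly_monotone_imp_redundant_coordinate: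
  assumes "\<not> strictly_monotone E N"
  obtains h \<gamma> b where "h \<in> E" "\<And>\<delta>. 0 \<le> h \<delta>" "h \<gamma> = 0" "b > 0" "0 < N h"
    "N (\<lambda>\<delta>. h \<delta> + single \<gamma> b \<delta>) = N h"
proof -
  obtain x y where x: "x \<in> E" and y: "y \<in> E" "0 \<le> y" "y \<le> x" "y \<noteq> x" and N: "N x \<le> N y"
    using assms unfolding strictly_monotone_def by (auto simp: not_less)
  have pos: "0 \<le> y \<delta>" "y \<delta> \<le> x \<delta>" for \<delta> using y by (auto dest: le_funD)
  obtain \<gamma> where "y \<gamma> \<noteq> x \<gamma>" using y(4) by blast
  then have \<gamma>: "y \<gamma> < x \<gamma>" using pos[of \<gamma>] by simp
  define b where "b = x \<gamma>"
  define t where "t = y \<gamma> / b"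
  have b: "b > 0" using \<gamma> pos[of \<gamma>] by (simp add: b_def)
  have t: "0 \<le> t" "t < 1" "t * b = y \<gamma>" using \<gamma> pos(1)[of \<gamma>] b by (simp_all add: t_def b_def)
  define h where "h = x(\<gamma> := 0)"
  have h: "h \<in> E" "N h \<le> N x"
    by (rule ideal_mem[OF x] norm_mono[OF x]; simp add: h_def)+
  have hx: "(\<lambda>\<delta>. h \<delta> + single \<gamma> b \<delta>) = x" by (auto simp: h_def b_def single_def)
  have "N y \<le> N (\<lambda>\<delta>. (1 - t) * h \<delta> + t * x \<delta>)"
  proof (rule norm_mono[OF add_mem[OF scale_mem[OF h(1)] scale_mem[OF x]]])
    fix \<delta>
    have "y \<delta> \<le> (1 - t) * h \<delta> + t * x \<delta>"
    proof (cases "\<delta> = \<gamma>")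
      case True
      then show ?thesis using t(3) by (simp add: h_def b_def)
    next
      case False
      then show ?thesis using pos(2)[of \<delta>] by (simp add: h_def algebra_simps)
    qed
    then show "\<bar>y \<delta>\<bar> \<le> \<bar>(1 - t) * h \<delta> + t * x \<delta>\<bar>" using pos(1)[of \<delta>] by simp
  qed
  also have "\<dots> \<le> (1 - t) * N h + t * N x"
    using norm_add_le[OF scale_mem[OF h(1), of "1 - t"] scale_mem[OF x, of t]] t
    by (simp add: norm_scale h x)
  finally have "(1 - t) * N x \<le> (1 - t) * N h" using N by (simp add: algebra_simps)
  then have Nh: "N x = N h" using h(2) t(2) by (simp add: mult_le_cancel_left)
  have "N x \<noteq> 0" using norm_eq_0_iff[OF x] b by (auto simp: b_def)
  then have "0 < N h" using norm_nonneg[OF x] Nh by simp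
  moreover have "0 \<le> h \<delta>" for \<delta> using pos[of \<delta>] by (simp add: h_def)
  ultimately show ?thesis using that[of h \<gamma> b] h(1) b hx Nh by (simp add: h_def)
qed

text \<open>
  Let \<open>x\<close> be the function \<open>h u 0\<close>, normalized, and let \<open>w n\<close> be the multiple of \<open>u n\<close> placed at the
  redundant coordinate. Then \<open>x + w n\<close> and \<open>x\<close> are unit vectors, \<open>x + w n \<rightarrow> x\<close> weakly, and \<open>w n\<close>
  has constant positive norm.
\<close>
lemma schur_or_strictly_monotone_of_kothe_bochner:
  assumes H: "H_weak (kothe_bochner E :: ('g \<Rightarrow> 'x::real_normed_vector) set) (kothe_bochner_norm N)"
  shows "schur_property (UNIV :: 'x set) norm \<or> strictly_monotone E N"
proof (rule ccontr)
  assume "\<not> ?thesis"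
  then have not_schur: "\<not> schur_property (UNIV :: 'x set) norm"
    and not_SM: "\<not> strictly_monotone E N" by auto
  obtain u :: "nat \<Rightarrow> 'x" where u: "\<And>n. norm (u n) = 1"
    "limitin (weak_topology UNIV norm) u 0 sequentially"
    by (rule not_schur_imp_unit_weakly_null[OF not_schur]) (assumption | rule that)+
  obtain h \<gamma> b where h: "h \<in> E" "\<And>\<delta>. 0 \<le> h \<delta>" "h \<gamma> = 0" and b: "b > 0" and Nh: "0 < N h"
    and eq: "N (\<lambda>\<delta>. h \<delta> + single \<gamma> b \<delta>) = N h"
    by (rule not_strictly_monotone_imp_redundant_coordinate[OF not_SM]) (assumption | rule that)+
  define c where "c = inverse (N h)"
  have c: "c > 0" "c * N h = 1" using Nh by (simp_all add: c_def)
  define x :: "'g \<Rightarrow> 'x" where "x = (\<lambda>\<delta>. (c * h \<delta>) *\<^sub>R u 0)"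
  define w where "w n = single \<gamma> ((c * b) *\<^sub>R u n)" for n
  have nx: "(\<lambda>\<delta>. norm (x \<delta>)) = (\<lambda>\<delta>. c * h \<delta>)"
    using c(1) h(2) u(1) by (simp add: x_def abs_mult)
  then have x: "x \<in> kothe_bochner E" "kothe_bochner_norm N x = 1"
    using scale_mem[OF h(1), of c] norm_scale[OF h(1), of c] c
    by (simp_all add: kothe_bochner_def kothe_bochner_norm_def)
  have "(\<lambda>\<delta>. norm ((x + w n) \<delta>)) = (\<lambda>\<delta>. c * (h \<delta> + single \<gamma> b \<delta>))" for n
    using c(1) b h(2,3) u(1) by (auto simp: x_def w_def single_def fun_eq_iff plus_fun_def abs_mult)
  then have xw: "kothe_bochner_norm N (x + w n) = 1" for n
    using norm_scale[OF add_mem[OF h(1) single_mem], of c] c eq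
    by (simp add: kothe_bochner_norm_def)
  have wE: "w n \<in> kothe_bochner E" for n unfolding w_def by (rule single_mem_kothe_bochner)
  have "limitin (weak_topology UNIV norm) (\<lambda>n. (c * b) *\<^sub>R u n) ((c * b) *\<^sub>R 0) sequentially"
    by (rule weak_limit_scaleR[OF u(2)])
  then have "limitin (weak_topology (kothe_bochner E) (kothe_bochner_norm N)) (\<lambda>n. x + w n)
      (x + single \<gamma> ((c * b) *\<^sub>R 0)) sequentially"
    unfolding w_def by (rule weak_limit_perturb_coordinate[OF _ x(1)])
  moreover have "x + single \<gamma> ((c * b) *\<^sub>R 0) = x" by (auto simp: single_def plus_fun_def)
  ultimately have "limitin (weak_topology (kothe_bochner E) (kothe_bochner_norm N))
      (\<lambda>n. x + w n) x sequentially" by simp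
  then have "(\<lambda>n. kothe_bochner_norm N (x + w n - x)) \<longlonglongrightarrow> 0"
    by (intro kadets_kleeD[OF H] add_mem_kothe_bochner x wE xw)
  moreover have "kothe_bochner_norm N (x + w n - x) = c * b * N (single \<gamma> 1)" for n
    using c(1) b u(1) by (simp add: w_def kothe_bochner_norm_single abs_mult)
  ultimately have "c * b * N (single \<gamma> 1) = 0" by (simp add: LIMSEQ_const_iff)
  then show False using c(1) b norm_single_pos[of \<gamma>] by simp
qed

end

theorem corollary5p1p7:
  fixes E :: "('g::countable \<Rightarrow> real) set" and N :: "('g \<Rightarrow> real) \<Rightarrow> real"
  assumes "infinite_dimensional (UNIV :: 'x::banach set)"
    and "banach_sequence_space E N"
    and "monotone_complete E N"
    and "H_pointwise E N"
  shows "H_weak (kothe_bochner E :: ('g \<Rightarrow> 'x) set) (kothe_bochner_norm N) \<longleftrightarrow>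
    H_weak (UNIV :: 'x set) norm \<and>
    (schur_property (UNIV :: 'x set) norm \<or> strictly_monotone E N)"
proof -
  interpret sequence_space E N by (rule sequence_space.intro) (rule assms(2))
  show ?thesis
  proof (intro iffI conjI; (elim conjE)?)
    assume H: "H_weak (kothe_bochner E :: ('g \<Rightarrow> 'x) set) (kothe_bochner_norm N)"
    show "H_weak (UNIV :: 'x set) norm" by (rule H_weak_of_kothe_bochner[OF H])
    show "schur_property (UNIV :: 'x set) norm \<or> strictly_monotone E N"
      by (rule schur_or_strictly_monotone_of_kothe_bochner[OF H])
  qed (rule H_weak_kothe_bochner[OF assms(4,3)])
qed

end
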